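(* Let $\lambda$ be a fixed even partition such that all zeros of $H=H_\lambda$ are simple, and let $m=\deg H=|\lambda|$. There is a constant $K(m)>0$, independent of $n$, such that for the matrix $\mathbf{\hat H}=D^{-1}\mathbf{H}(Z)D$ formed with this constant the following holds for all sufficiently large $n$: $G_r\subset\mathbb{R}_-$ (the negative reals), and if $x\in G_r$ then $|x|\le cn$; if $x\in G_e$, then $|x|\sim n$, i.e. $c_1n\le|x|\le c_2n$. Here $c,c_1,c_2>0$ are constants independent of $n$.
   Context: A partition of length $r$ is $\lambda=(\lambda_1\ge\dots\ge\lambda_r\ge 1)$, $|\lambda|=\sum_i\lambda_i$. It is even if $r$ is even and $\lambda_{2k-1}=\lambda_{2k}$ for $k=1,\dots,r/2$. With $H_j$ the classical Hermite polynomials (orthogonal with respect to $e^{-x^2}$ on $\mathbb{R}$) and $\mathrm{Wr}$ the Wronskian determinant, the generalized Hermite polynomial is $H_\lambda=\mathrm{Wr}[H_{\lambda_r},\dots,H_{\lambda_2+r-2},H_{\lambda_1+r-1}]$, of degree $|\lambda|$; for even $\lambda$ it has no real zeros. Write $H=H_\lambda$, $m=\deg H=|\lambda|$. Let $n\ge\lambda_1$. The exceptional Hermite polynomial of degree $m+n$ is $P_{m,m+n}=\mathrm{Wr}[H_{\lambda_r},\dots,H_{\lambda_2+r-2},H_{\lambda_1+r-1},H_{n+r}]$. Known: for $n$ large it has exactly $m$ non-real ("exceptional") zeros $z_k=\xi_k+i\eta_k$, $k=1,\dots,m$, and $n$ real ("regular") zeros $x_1,\dots,x_n$. They are labelled so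 that $z_k$ tends to the zero $w_k$ of $H$ as $n\to\infty$. $Z$ denotes the set of all these zeros. Let $w(z)=|e^{-z^2}|/|H(z)|^2$ on $\mathbb{C}$. The logarithmic energy function is the function of $2m+n$ real variables, with $\dot z_k=\dot\xi_k+i\dot\eta_k$, $$F(\dot\xi_1,\dot\eta_1,\dots,\dot\xi_m,\dot\eta_m,\dot x_1,\dots,\dot x_n)=\sum_{k=1}^m\log w(\dot z_k)+\sum_{i=1}^n\log w(\dot x_i)+\sum_{1\le k<l\le m}\log|\dot z_k-\dot z_l|^2+\sum_{1\le i<j\le n}\log|\dot x_i-\dot x_j|^2+\sum_{k=1}^m\sum_{i=1}^n\log|\dot x_i-\dot z_k|^2 .$$ $\mathbf{H}$ is the matrix of second partial derivatives of $F$ with the variables in the order $\dot\xi_1,\dot\eta_1,\dots,\dot\xi_m,\dot\eta_m,\dot x_1,\dots,\dot x_n$; $\mathbf{H}(Z)$ is its value at $\dot\xi_k=\xi_k$, $\dot\eta_k=\eta_k$, $\dot x_i=x_i$. $D$ is the diagonal matrix of size $2m+n$ with $d_{kk}=1$ for $k=1,\dots,2m$ and $d_{2m+i,2m+i}=K(m)$ for $i=1,\dots,n$. Partition the $2m+n$ coordinates into $m$ consecutive pairs (the pair $(2k-1,2k)$, corresponding to $(\xi_k,\eta_k)$, $k=1,\dots,m$) followed by $n$ singletons (corresponding to $x_1,\dots,x_n$), and write $\mathbf{\hat H}=[A_{i,j}]_{i,j=1}^{m+n}$ in the corresponding blocks. Matrix norms are $\ell_\infty$-norms: $\|A\|=\max_i\sum_j|a_{i,j}|$.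 For $i=1,\dots,m+n$ the $i$-th block Gersgorin set is $$G_i=\Big\{z\in\mathbb{C}:\ \big(\|(zI_i-A_{i,i})^{-1}\|\big)^{-1}\le\sum_{1\le j\le m+n,\ j\ne i}\|A_{i,j}\|\Big\},$$ where $I_i$ is the identity of the size of the block $A_{i,i}$ and the left-hand side is read as $0$ when $zI_i-A_{i,i}$ is singular. Define $$G_r=\Big(\bigcup_{i=1}^nG_{m+i}\Big)\cap\mathbb{R},\qquad G_e=\Big(\bigcup_{k=1}^mG_k\Big)\cap\mathbb{R}.$$ *)

theory Defs
  imports
    "HOL-Computational_Algebra.Polynomial"
    "HOL-Analysis.Derivative"
    "Jordan_Normal_Form.Determinant"
    "Jordan_Normal_Form.Gauss_Jordan_Elimination"
    "Jordan_Normal_Form.DL_Submatrix"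
begin

text \<open>All enumerations below are zero-based.  A partition is the list
  of its parts in weakly decreasing order, so its size is \<^term>\<open>sum_list lam\<close>.\<close>

definition is_partition :: "nat list \<Rightarrow> bool" where
  "is_partition lam \<longleftrightarrow> sorted_wrt (\<ge>) lam \<and> (\<forall>p\<in>set lam. 1 \<le> p)"

definition even_partition :: "nat list \<Rightarrow> bool" where
  "even_partition lam \<longleftrightarrow> is_partition lam \<and> even (length lam) \<and>
     (\<forall>k < length lam div 2. lam ! (2 * k) = lam ! (2 * k + 1))"

text \<open>The classical (physicists') normalisation: weight \<open>exp (-x\<^sup>2)\<close>, leading
  coefficient \<open>2^j\<close>.\<close>

fun hermite :: "nat \<Rightarrow> complex poly" where
  "hermite 0 = 1"
| "hermite (Suc 0) = [:0, 2:]"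
| "hermite (Suc (Suc j)) =
     [:0, 2:] * hermite (Suc j) - smult (2 * of_nat (Suc j)) (hermite j)"

definition wronskian :: "complex poly list \<Rightarrow> complex poly" where
  "wronskian fs = det (mat (length fs) (length fs) (\<lambda>(i, j). (pderiv ^^ i) (fs ! j)))"

text \<open>The list \<open>H\<^bsub>\<lambda>_r\<^esub>, \<dots>, H\<^bsub>\<lambda>_2+r-2\<^esub>, H\<^bsub>\<lambda>_1+r-1\<^esub>\<close>.\<close>

definition hermite_seq :: "nat list \<Rightarrow> complex poly list" where
  "hermite_seq lam = map (\<lambda>j. hermite (rev lam ! j + j)) [0..<length lam]"

definition gen_hermite :: "nat list \<Rightarrow> complex poly" where
  "gen_hermite lam = wronskian (hermite_seq lam)"

text \<open>The polynomial \<open>P\<^bsub>m,m+n\<^esub>\<close>, where \<open>m\<close> is the size of the partition.\<close>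

definition exc_hermite :: "nat list \<Rightarrow> nat \<Rightarrow> complex poly" where
  "exc_hermite lam n = wronskian (hermite_seq lam @ [hermite (n + length lam)])"

definition weight :: "complex poly \<Rightarrow> complex \<Rightarrow> real" where
  "weight H u = cmod (exp (- u\<^sup>2)) / (cmod (poly H u))\<^sup>2"

text \<open>The point \<open>(\<xi>\<^sub>1, \<eta>\<^sub>1, \<dots>, \<xi>\<^sub>m, \<eta>\<^sub>m, x\<^sub>1, \<dots>, x\<^sub>n)\<close> is represented by a function on
  the naturals of which only the arguments below \<open>2m + n\<close> matter.\<close>

definition exc_coord :: "(nat \<Rightarrow> real) \<Rightarrow> nat \<Rightarrow> complex" where
  "exc_coord v k = Complex (v (2 * k)) (v (2 * k + 1))"

definition reg_coord :: "nat \<Rightarrow> (nat \<Rightarrow> real) \<Rightarrow> nat \<Rightarrow> real" where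
  "reg_coord m v i = v (2 * m + i)"

definition zero_point :: "nat \<Rightarrow> (nat \<Rightarrow> complex) \<Rightarrow> (nat \<Rightarrow> real) \<Rightarrow> nat \<Rightarrow> real" where
  "zero_point m z x j =
     (if j < 2 * m then (if even j then Re (z (j div 2)) else Im (z (j div 2)))
      else x (j - 2 * m))"

definition log_energy :: "complex poly \<Rightarrow> nat \<Rightarrow> nat \<Rightarrow> (nat \<Rightarrow> real) \<Rightarrow> real" where
  "log_energy H m n v =
     (\<Sum>k<m. ln (weight H (exc_coord v k)))
   + (\<Sum>i<n. ln (weight H (complex_of_real (reg_coord m v i))))
   + (\<Sum>l<m. \<Sum>k<l. ln ((cmod (exc_coord v k - exc_coord v l))\<^sup>2))
   + (\<Sum>j<n. \<Sum>i<j. ln (\<bar>reg_coord m v i - reg_coord m v j\<bar>\<^sup>2))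
   + (\<Sum>k<m. \<Sum>i<n. ln ((cmod (complex_of_real (reg_coord m v i) - exc_coord v k))\<^sup>2))"

definition partial_deriv :: "nat \<Rightarrow> ((nat \<Rightarrow> real) \<Rightarrow> real) \<Rightarrow> (nat \<Rightarrow> real) \<Rightarrow> real" where
  "partial_deriv j f v = deriv (\<lambda>t. f (v(j := t))) (v j)"

definition hessian_mat :: "nat \<Rightarrow> ((nat \<Rightarrow> real) \<Rightarrow> real) \<Rightarrow> (nat \<Rightarrow> real) \<Rightarrow> real mat" where
  "hessian_mat N f v = mat N N (\<lambda>(i, j). partial_deriv i (partial_deriv j f) v)"

definition scaling_mat :: "nat \<Rightarrow> nat \<Rightarrow> real \<Rightarrow> real mat" where
  "scaling_mat m n K = mat (2 * m + n) (2 * m + n)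
     (\<lambda>(i, j). if i = j then (if i < 2 * m then 1 else K) else 0)"

text \<open>The matrix \<open>D\<^sup>-\<^sup>1 H(Z) D\<close>.  The scaling matrix is invertible for
  \<open>K \<noteq> 0\<close>, so \<^const>\<open>the\<close> is applied to a defined value.\<close>

definition scaled_hessian ::
  "nat list \<Rightarrow> nat \<Rightarrow> real \<Rightarrow> (nat \<Rightarrow> complex) \<Rightarrow> (nat \<Rightarrow> real) \<Rightarrow> real mat" where
  "scaled_hessian lam n K z x =
     (let m = sum_list lam; D = scaling_mat m n K in
      the (mat_inverse D)
      * hessian_mat (2 * m + n) (log_energy (gen_hermite lam) m n) (zero_point m z x)
      * D)"

text \<open>The \<open>\<ell>\<^sub>\<infinity>\<close> operator norm; only used for matrices with at least one row.\<close>

definition linf_norm :: "complex mat \<Rightarrow> real" where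
  "linf_norm A = Max ((\<lambda>i. \<Sum>j<dim_col A. cmod (A $$ (i, j))) ` {..<dim_row A})"

text \<open>The first \<open>m\<close> blocks are pairs, all later ones are singletons.\<close>

definition block_idx :: "nat \<Rightarrow> nat \<Rightarrow> nat set" where
  "block_idx m i = (if i < m then {2 * i, 2 * i + 1} else {m + i})"

definition block :: "nat \<Rightarrow> complex mat \<Rightarrow> nat \<Rightarrow> nat \<Rightarrow> complex mat" where
  "block m A i j = submatrix A (block_idx m i) (block_idx m j)"

text \<open>\<^const>\<open>mat_inverse\<close> returns \<^const>\<open>None\<close> exactly on the singular matrices.\<close>

definition inv_norm_inv :: "complex mat \<Rightarrow> real" where
  "inv_norm_inv M = (case mat_inverse M of None \<Rightarrow> 0 | Some B \<Rightarrow> inverse (linf_norm B))"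

definition gersgorin :: "nat \<Rightarrow> nat \<Rightarrow> complex mat \<Rightarrow> nat \<Rightarrow> complex set" where
  "gersgorin m n A i =
     {u. inv_norm_inv (u \<cdot>\<^sub>m 1\<^sub>m (dim_row (block m A i i)) - block m A i i)
         \<le> (\<Sum>j\<in>{..<m + n} - {i}. linf_norm (block m A i j))}"

text \<open>The intersections with the real line, as sets of real numbers.\<close>

definition G_reg :: "nat \<Rightarrow> nat \<Rightarrow> real mat \<Rightarrow> real set" where
  "G_reg m n A =
     complex_of_real -` (\<Union>i<n. gersgorin m n (map_mat complex_of_real A) (m + i))"

definition G_exc :: "nat \<Rightarrow> nat \<Rightarrow> real mat \<Rightarrow> real set" where
  "G_exc m n A =
     complex_of_real -` (\<Union>k<m. gersgorin m n (map_mat complex_of_real A) k)"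

text \<open>\<open>w\<close> enumerates the (distinct) zeros of \<open>H\<close>; for all large \<open>n\<close>, \<open>z n\<close> and \<open>x n\<close>
  enumerate the \<open>m\<close> non-real and the \<open>n\<close> real zeros of the exceptional Hermite
  polynomial of degree \<open>m + n\<close>, in such a way that \<open>z n k\<close> tends to \<open>w k\<close>.\<close>

definition zero_labelling ::
  "nat list \<Rightarrow> (nat \<Rightarrow> complex) \<Rightarrow> (nat \<Rightarrow> nat \<Rightarrow> complex) \<Rightarrow> (nat \<Rightarrow> nat \<Rightarrow> real) \<Rightarrow> bool" where
  "zero_labelling lam w z x \<longleftrightarrow>
     bij_betw w {..<sum_list lam} {u. poly (gen_hermite lam) u = 0} \<and>
     (\<forall>\<^sub>F n in sequentially.
        bij_betw (z n) {..<sum_list lam} {u. poly (exc_hermite lam n) u = 0 \<and> Im u \<noteq> 0} \<and>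
        bij_betw (x n) {..<n} {t. poly (exc_hermite lam n) (complex_of_real t) = 0}) \<and>
     (\<forall>k<sum_list lam. (\<lambda>n. z n k) \<longlonglongrightarrow> w k)"

end

theory Submission
  imports Defs
begin

text \<open>
  The Wronskians \<open>H\<close> and \<open>P\<close> satisfy
  \<open>H P'' - 2 (x H + H') P' + (H'' + 2 x H' + 2 n H) P = 0\<close>: the Hermite equation expresses
  every derivative of order \<open>k + 2\<close> by those of orders \<open>k + 1\<close> and \<open>k\<close>, and what remains is
  a three-term Pluecker relation between minors.  Evaluated at a zero \<open>y\<close> of \<open>P\<close>, the equation
  and its derivative give the Stieltjes relations for \<open>\<Sum> 1 / (y - y')\<close> and
  \<open>\<Sum> 1 / (y - y')\<^sup>2\<close> over the other zeros, and so the diagonal blocks of the Hessian.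

  At an exceptional zero \<open>z\<close> close to a zero \<open>w\<close> of \<open>H\<close> put \<open>s = 1 / \<bar>z - w\<bar>\<close>.  As the
  \<open>x\<^sub>i\<close> are real, \<open>\<bar>Im z\<bar> \<Sum> 1 / \<bar>z - x\<^sub>i\<bar>\<^sup>2\<close> is the modulus of the imaginary part of
  \<open>\<Sum> 1 / (z - x\<^sub>i)\<close>, hence \<open>O(1 + s)\<close> by the first relation; inserted in the second one this gives
  \<open>1 / (z - w)\<^sup>2 = - 2 n + O(1 + s)\<close>, so \<open>s\<close> is of order \<open>\<surd>n\<close>, the block is
  \<open>- 4 n\<close> up to \<open>o(n)\<close>, and its radius is \<open>o(n)\<close>.  At a regular zero the radius nearly cancels the
  sum over the regular zeros, and the rest is negative once \<open>K\<close> is large.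
\<close>

subsection \<open>Determinants as functions of their rows\<close>

text \<open>Away from collisions and from the zeros of \<open>H\<close>, the energy is locally the
  real part of a holomorphic function of \<open>m + n\<close> complex points, the regular ones
  restricted to the real line. A Hessian entry is therefore
  \<open>Re (d_i * d_j * \<Psi> a b)\<close> with directions 1 or \<open>\<i>\<close> and a complex
  symbol \<open>\<Psi>\<close>. The diagonal block of a pair is symmetric of trace 0 with
  eigenvalues plus and minus \<open>cmod (\<Psi> a a)\<close>, so the exceptional sets are located
  in modulus only. Conjugation by \<open>D\<close> divides the exceptional columns in a regular row
  by \<open>K\<close> and multiplies the regular columns in an exceptional row by \<open>K\<close>.
  The former must be small, since after the cancellation in a regular row only a margin of constant
  size is left. The latter is affordable, since \<open>K\<close> multiplies a sum of order O(1 + s),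
  against a centre close to \<open>- 4 n\<close>. In a regular row the terms
  \<open>1 / (x_i - w_k)^2\<close> of the weight are offset by the interactions
  \<open>1 / (x_i - z_k)^2\<close>, because \<open>z_k\<close> tends to \<open>w_k\<close>. This
  uses that \<open>w_k\<close> is non-real, which is read off the labelling by conjugation.\<close>

definition row_det :: "nat \<Rightarrow> (nat \<Rightarrow> nat \<Rightarrow> 'a) \<Rightarrow> 'a::comm_ring_1" where
  "row_det N g = det (mat N N (\<lambda>(i, j). g i j))"

lemma row_det_leibniz:
  "row_det N g = (\<Sum>p | p permutes {0..<N}. signof p * (\<Prod>i = 0..<N. g i (p i)))"
proof -
  have "row_det N g = (\<Sum>p | p permutes {0..<N}. signof p *
      (\<Prod>i = 0..<N. mat N N (\<lambda>(i, j). g i j) $$ (i, p i)))"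
    unfolding row_det_def by (rule det_def') simp
  also have "\<dots> = (\<Sum>p | p permutes {0..<N}. signof p * (\<Prod>i = 0..<N. g i (p i)))"
  proof (intro sum.cong refl arg_cong2[of _ _ _ _ "(*)"] prod.cong)
    fix p i assume "p \<in> {p. p permutes {0..<N}}" "i \<in> {0..<N}"
    then have "p i < N" "i < N" using permutes_in_image[of p "{0..<N}" i] by auto
    then show "mat N N (\<lambda>(i, j). g i j) $$ (i, p i) = g i (p i)" by simp
  qed
  finally show ?thesis .
qed

lemma row_det_cong:
  assumes "\<And>i j. i < N \<Longrightarrow> j < N \<Longrightarrow> g i j = g' i j"
  shows "row_det N g = row_det N g'"
  unfolding row_det_def by (intro arg_cong[of _ _ det] eq_matI) (auto simp: assms)

lemma row_det_upd_leibniz: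
  assumes "k < N"
  shows "row_det N (g(k := c)) = (\<Sum>p | p permutes {0..<N}.
           signof p * (c (p k) * (\<Prod>i\<in>{0..<N} - {k}. g i (p i))))"
  unfolding row_det_leibniz
proof (intro sum.cong refl arg_cong2[of _ _ _ _ "(*)"])
  fix p
  have "(\<Prod>i = 0..<N. (g(k := c)) i (p i)) =
      c (p k) * (\<Prod>i\<in>{0..<N} - {k}. (g(k := c)) i (p i))"
    using assms by (subst prod.remove[of _ k]) auto
  also have "(\<Prod>i\<in>{0..<N} - {k}. (g(k := c)) i (p i)) = (\<Prod>i\<in>{0..<N} - {k}. g i (p i))"
    by (intro prod.cong) auto
  finally show "(\<Prod>i = 0..<N. (g(k := c)) i (p i)) =
      c (p k) * (\<Prod>i\<in>{0..<N} - {k}. g i (p i))" .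
qed

lemma row_det_upd_sum:
  "(\<Sum>k<N. row_det N (g(k := c k))) = (\<Sum>p | p permutes {0..<N}.
     signof p * (\<Sum>k = 0..<N. c k (p k) * (\<Prod>i\<in>{0..<N} - {k}. g i (p i))))"
  by (simp add: row_det_upd_leibniz sum_distrib_left lessThan_atLeast0)
    (subst sum.swap, simp)

lemma pderiv_signof: "pderiv (signof p * f) = signof p * pderiv (f :: 'a::idom poly)"
  by (simp add: sign_def pderiv_minus)

lemma pderiv_row_det:
  fixes g :: "nat \<Rightarrow> nat \<Rightarrow> 'a::idom poly"
  shows "pderiv (row_det N g) = (\<Sum>k<N. row_det N (g(k := \<lambda>j. pderiv (g k j))))"
  unfolding row_det_upd_sum row_det_leibniz[of N g]
  using higher_pderiv_sum[of 1 "\<lambda>p. signof p * (\<Prod>i = 0..<N. g i (p i))"]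
  by (simp add: pderiv_signof pderiv_prod mult.commute)

text \<open>In each Leibniz term every column occurs exactly once, so the factors
  \<open>c (p k)\<close> add up to the trace of the diagonal matrix of \<open>c\<close>, whatever
  the permutation. This treats coefficients depending on the column, which cannot be pulled out of a
  row.\<close>

lemma row_det_trace:
  "(\<Sum>k<N. row_det N (g(k := \<lambda>j. c j * g k j))) = (\<Sum>j<N. c j) * row_det N g"
proof -
  have "(\<Sum>k = 0..<N. c (p k) * g k (p k) * (\<Prod>i\<in>{0..<N} - {k}. g i (p i))) =
      (\<Sum>j<N. c j) * (\<Prod>i = 0..<N. g i (p i))" if p: "p permutes {0..<N}" for p
  proof -
    have "(\<Sum>k = 0..<N. c (p k) * g k (p k) * (\<Prod>i\<in>{0..<N} - {k}. g i (p i))) =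
        (\<Sum>k = 0..<N. c (p k) * (\<Prod>i = 0..<N. g i (p i)))"
      by (intro sum.cong refl) (simp add: prod.remove mult.assoc)
    also have "\<dots> = (\<Sum>k = 0..<N. c (p k)) * (\<Prod>i = 0..<N. g i (p i))"
      by (simp add: sum_distrib_right)
    also have "(\<Sum>k = 0..<N. c (p k)) = (\<Sum>j<N. c j)"
      using sum.permute[OF p, of c] by (simp add: lessThan_atLeast0 comp_def)
    finally show ?thesis .
  qed
  then show ?thesis
    unfolding row_det_upd_sum row_det_leibniz[of N g] sum_distrib_left[of "sum c {..<N}"]
    by (intro sum.cong refl) (simp add: mult.left_commute)
qed

lemma row_det_upd_add:
  assumes "k < N"
  shows "row_det N (g(k := \<lambda>j. u j + v j)) = row_det N (g(k := u)) + row_det N (g(k := v))"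
  using assms by (simp add: row_det_upd_leibniz algebra_simps sum.distrib)

lemma row_det_upd_mult:
  assumes "k < N"
  shows "row_det N (g(k := \<lambda>j. a * u j)) = a * row_det N (g(k := u))"
  using assms by (simp add: row_det_upd_leibniz sum_distrib_left mult_ac)

lemma row_det_upd_sum_row:
  assumes "k < N" "finite S"
  shows "row_det N (g(k := \<lambda>j. \<Sum>s\<in>S. a s * u s j)) = (\<Sum>s\<in>S. a s * row_det N (g(k := u s)))"
  using assms(2)
proof (induction S rule: finite_induct)
  case empty
  then show ?case using assms(1) row_det_upd_leibniz[of k N g "\<lambda>_. 0"]
    by (simp del: fun_upd_apply)
next
  case (insert s S)
  then show ?case using assms(1) by (simp add: row_det_upd_add row_det_upd_mult del: fun_upd_apply)
qed

lemma row_det_equal_rows: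
  assumes "i < N" "k < N" "i \<noteq> k" "g i = g k"
  shows "row_det N g = 0"
  unfolding row_det_def
  by (rule det_identical_rows[of _ N i k]) (use assms in auto)

text \<open>Expand the determinant that has \<open>a + b\<close> in both rows: it vanishes, and so
  do the two terms with equal rows.\<close>

lemma row_det_swap:
  assumes "i < N" "k < N" "i \<noteq> k"
  shows "row_det N (g(i := a, k := b)) = - row_det N (g(i := b, k := a))"
proof -
  have "row_det N (g(i := \<lambda>j. a j + b j, k := \<lambda>j. a j + b j)) = 0"
    using assms by (intro row_det_equal_rows[of i N k]) auto
  moreover have "row_det N (g(i := u, k := u)) = 0" for u
    using assms by (intro row_det_equal_rows[of i N k]) auto
  ultimately have "row_det N (g(i := a, k := b)) + row_det N (g(i := b, k := a)) = 0"
    using assms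
    by (simp add: row_det_upd_add fun_upd_twist[of i k])
      (simp add: fun_upd_twist[of k i] row_det_upd_add add.commute)
  then show ?thesis by (simp add: eq_neg_iff_add_eq_0)
qed

text \<open>Cramer's rule without division: multiply \<open>adj A * A = det A * 1\<close> from the
  left by the row vector \<open>c\<close>. The determinants with row \<open>k\<close> replaced by
  \<open>c\<close> are the entries of \<open>c * adj A\<close>. No inverse occurs, so polynomial
  entries are admissible.\<close>

lemma row_det_cramer:
  assumes "j < N"
  shows "c j * row_det N g = (\<Sum>k<N. row_det N (g(k := c)) * g k j)"
proof -
  let ?A = "mat N N (\<lambda>(i, j). g i j)"
  have A: "?A \<in> carrier_mat N N" by simp
  have exp: "row_det N (g(k := c)) = (\<Sum>l<N. c l * cofactor ?A k l)" if k: "k < N" for k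
  proof -
    have "mat_delete (mat N N (\<lambda>(i, j). (g(k := c)) i j)) k l = mat_delete ?A k l"
      if "l < N" for l
      using k that by (intro eq_matI) (auto simp: mat_delete_def)
    then show ?thesis
      unfolding row_det_def
      by (subst laplace_expansion_row[OF _ k])
        (auto simp: k cofactor_def intro!: sum.cong simp del: fun_upd_apply simp: fun_upd_same)
  qed
  have "(\<Sum>k<N. cofactor ?A k l * g k j) = (if l = j then row_det N g else 0)" if l: "l < N" for l
  proof -
    have "(\<Sum>k<N. cofactor ?A k l * g k j) = (adj_mat ?A * ?A) $$ (l, j)"
      using l assms by (simp add: adj_mat_def scalar_prod_def lessThan_atLeast0)
    then show ?thesis using l assms by (simp add: adj_mat(3)[OF A] row_det_def)
  qed
  then have "(\<Sum>l<N. c l * (\<Sum>k<N. cofactor ?A k l * g k j)) = c j * row_det N g"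
    using assms by (simp add: sum.delta if_distrib[of "(*) _"] cong: if_cong)
  moreover have "(\<Sum>k<N. row_det N (g(k := c)) * g k j) =
      (\<Sum>l<N. c l * (\<Sum>k<N. cofactor ?A k l * g k j))"
    by (simp add: exp sum_distrib_left sum_distrib_right mult.assoc) (subst sum.swap, simp)
  ultimately show ?thesis by simp
qed

text \<open>Expand the row \<open>c\<close> in the rows \<open>g 0, \<dots>, a, b\<close> by Cramer's rule and substitute the
  expansion into the minor of \<open>c\<close> and \<open>d\<close>.\<close>

lemma row_det_pluecker:
  fixes g :: "nat \<Rightarrow> nat \<Rightarrow> 'a::comm_ring_1" and M :: nat
  defines "\<omega> \<equiv> \<lambda>a b. row_det (Suc (Suc M)) (g(M := a, Suc M := b))"
  shows "\<omega> a b * \<omega> c d - \<omega> a c * \<omega> b d + \<omega> a d * \<omega> b c = 0"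
proof -
  let ?N = "Suc (Suc M)"
  let ?g = "g(M := a, Suc M := b)"
  let ?\<mu> = "\<lambda>k. row_det ?N (?g(k := c))"
  have "\<omega> (\<lambda>j. \<omega> a b * c j) d = \<omega> (\<lambda>j. \<Sum>k<?N. ?\<mu> k * ?g k j) d"
    unfolding \<omega>_def
  proof (rule row_det_cong)
    fix i j assume "i < ?N" "j < ?N"
    with row_det_cramer[of j ?N c ?g]
    show "(g(M := \<lambda>j. row_det ?N ?g * c j, Suc M := d)) i j =
      (g(M := \<lambda>j. \<Sum>k<?N. ?\<mu> k * ?g k j, Suc M := d)) i j"
      by (auto simp: mult.commute)
  qed
  moreover have "\<omega> (\<lambda>j. x * c j) d = x * \<omega> c d" for x
    using row_det_upd_mult[of M ?N "g(Suc M := d)" x c]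
    by (simp add: \<omega>_def fun_upd_twist[of M "Suc M"])
  moreover have "\<omega> (\<lambda>j. \<Sum>k<?N. ?\<mu> k * ?g k j) d = (\<Sum>k<?N. ?\<mu> k * \<omega> (?g k) d)"
    using row_det_upd_sum_row[of M ?N "{..<?N}" "g(Suc M := d)" ?\<mu> ?g]
    by (simp only: \<omega>_def fun_upd_twist[of M "Suc M"]) simp
  moreover have "\<omega> (?g k) d = 0" if "k < M" for k
    unfolding \<omega>_def using that by (intro row_det_equal_rows[of k _ M]) auto
  moreover have "?\<mu> M = \<omega> c b" "?\<mu> (Suc M) = \<omega> a c"
    by (simp_all add: \<omega>_def fun_upd_twist[of M "Suc M"])
  ultimately have "\<omega> a b * \<omega> c d = \<omega> c b * \<omega> a d + \<omega> a c * \<omega> b d"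
    by simp
  moreover have "\<omega> c b = - \<omega> b c"
    unfolding \<omega>_def by (rule row_det_swap) auto
  ultimately show ?thesis by (simp add: algebra_simps)
qed

text \<open>A unit row at the bottom deletes itself and the last column. Thus smaller determinants
  can be written at the larger size, and one quadratic relation can involve Wronskians of two
  sizes.\<close>

lemma row_det_last_unit_row:
  assumes "g N = (\<lambda>j. if j = N then 1 else 0)"
  shows "row_det (Suc N) g = row_det N g"
proof -
  let ?A = "mat (Suc N) (Suc N) (\<lambda>(i, j). g i j)"
  have "row_det (Suc N) g = (\<Sum>j<Suc N. ?A $$ (N, j) * cofactor ?A N j)"
    unfolding row_det_def by (rule laplace_expansion_row) auto
  also have "\<dots> = cofactor ?A N N"
    by (simp add: assms)
  also have "mat_delete ?A N N = mat N N (\<lambda>(i, j). g i j)"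
    by (intro eq_matI) (auto simp: mat_delete_def)
  then have "cofactor ?A N N = row_det N g"
    by (simp add: cofactor_def row_det_def)
  finally show ?thesis .
qed

subsection \<open>The differential equation of the Wronskians\<close>

text \<open>The orders \<open>os\<close> are arbitrary because derivatives of a Wronskian are sums
  of such determinants whose orders have gaps.\<close>

definition gen_wronskian :: "nat \<Rightarrow> (nat \<Rightarrow> nat) \<Rightarrow> (nat \<Rightarrow> 'a::idom poly) \<Rightarrow> 'a poly" where
  "gen_wronskian N os F = row_det N (\<lambda>i j. (pderiv ^^ os i) (F j))"

definition two_x :: "complex poly" where
  "two_x = [:0, 2:]"

lemma pderiv_two_x: "pderiv two_x = 2"
  by (simp add: two_x_def pderiv_pCons numeral_poly)

lemma wronskian_eq_gen_wronskian:
  "wronskian fs = gen_wronskian (length fs) (\<lambda>i. i) (\<lambda>j. fs ! j)"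
  by (simp add: wronskian_def gen_wronskian_def row_det_def)

lemma gen_wronskian_upd:
  "gen_wronskian N (os(k := l)) F =
     row_det N ((\<lambda>i j. (pderiv ^^ os i) (F j))(k := \<lambda>j. (pderiv ^^ l) (F j)))"
  unfolding gen_wronskian_def by (intro row_det_cong) auto

lemma gen_wronskian_upd2:
  "gen_wronskian N ((\<lambda>i. i)(i := k, i' := l)) F =
     row_det N ((\<lambda>i j. (pderiv ^^ i) (F j))(i := \<lambda>j. (pderiv ^^ k) (F j), i' := \<lambda>j. (pderiv ^^ l) (F j)))"
  unfolding gen_wronskian_def by (intro row_det_cong) auto

lemma gen_wronskian_equal_orders:
  assumes "i < N" "k < N" "i \<noteq> k" "os i = os k"
  shows "gen_wronskian N os F = 0"
  unfolding gen_wronskian_def by (rule row_det_equal_rows[of i N k]) (use assms in auto)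

lemma pderiv_gen_wronskian:
  "pderiv (gen_wronskian N os F) = (\<Sum>k<N. gen_wronskian N (os(k := Suc (os k))) F)"
  unfolding gen_wronskian_upd by (simp add: pderiv_row_det gen_wronskian_def)

lemma hermite_ode_derivs:
  fixes f :: "complex poly"
  assumes "pderiv (pderiv f) = two_x * pderiv f - 2 * of_nat a * f"
  shows "(pderiv ^^ Suc (Suc k)) f =
    two_x * (pderiv ^^ Suc k) f + (2 * of_nat k - 2 * of_nat a) * (pderiv ^^ k) f"
proof (induction k)
  case 0
  then show ?case using assms by (simp add: algebra_simps)
next
  case (Suc k)
  have c: "pderiv (2 * of_nat k - 2 * of_nat a :: complex poly) = 0"
    by (simp add: pderiv_diff pderiv_mult pderiv_of_nat)
  have "(pderiv ^^ Suc (Suc (Suc k))) f = pderiv ((pderiv ^^ Suc (Suc k)) f)" by simp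
  also have "\<dots> = pderiv (two_x * (pderiv ^^ Suc k) f
      + (2 * of_nat k - 2 * of_nat a) * (pderiv ^^ k) f)"
    by (simp only: Suc.IH)
  also have "\<dots> = two_x * (pderiv ^^ Suc (Suc k)) f + 2 * (pderiv ^^ Suc k) f
      + (2 * of_nat k - 2 * of_nat a) * (pderiv ^^ Suc k) f"
    by (simp only: pderiv_add pderiv_mult c pderiv_two_x) (simp add: mult.commute)
  finally show ?case by (simp add: algebra_simps)
qed

text \<open>Insert the differentiated Hermite equation into one row at a time. The first-order parts
  sum to \<open>two_x\<close> times the derivative, the orders \<open>os k\<close> add up, and the
  eigenvalues \<open>a j\<close>, which depend on the column, come out through
  \<open>row_det_trace\<close>.\<close>

lemma gen_wronskian_trace:
  fixes F :: "nat \<Rightarrow> complex poly"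
  assumes ode: "\<And>j. j < N \<Longrightarrow>
    pderiv (pderiv (F j)) = two_x * pderiv (F j) - 2 * of_nat (a j) * F j"
  shows "(\<Sum>k<N. gen_wronskian N (os(k := Suc (Suc (os k)))) F) =
    two_x * pderiv (gen_wronskian N os F)
    + 2 * (of_nat (\<Sum>k<N. os k) - of_nat (\<Sum>j<N. a j)) * gen_wronskian N os F"
proof -
  let ?g = "\<lambda>i j. (pderiv ^^ os i) (F j)"
  have "gen_wronskian N (os(k := Suc (Suc (os k)))) F =
      two_x * gen_wronskian N (os(k := Suc (os k))) F + 2 * of_nat (os k) * gen_wronskian N os F
      - row_det N (?g(k := \<lambda>j. (2 * of_nat (a j)) * ?g k j))" if k: "k < N" for k
  proof -
    have "gen_wronskian N (os(k := Suc (Suc (os k)))) F =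
      row_det N (?g(k := \<lambda>j. (two_x * (pderiv ^^ Suc (os k)) (F j) + 2 * of_nat (os k) * ?g k j)
         + (-1) * ((2 * of_nat (a j)) * ?g k j)))"
      unfolding gen_wronskian_upd
      by (intro row_det_cong) (auto simp: hermite_ode_derivs[OF ode] algebra_simps simp del: funpow.simps)
    also have "\<dots> = two_x * row_det N (?g(k := \<lambda>j. (pderiv ^^ Suc (os k)) (F j)))
       + 2 * of_nat (os k) * row_det N (?g(k := ?g k))
       + (-1) * row_det N (?g(k := \<lambda>j. (2 * of_nat (a j)) * ?g k j))"
      by (simp only: row_det_upd_add[OF k] row_det_upd_mult[OF k])
    also have "?g(k := ?g k) = ?g" by auto
    finally show ?thesis
      unfolding gen_wronskian_upd by (simp add: gen_wronskian_def del: fun_upd_apply)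
  qed
  then have "(\<Sum>k<N. gen_wronskian N (os(k := Suc (Suc (os k)))) F) =
      (\<Sum>k<N. two_x * gen_wronskian N (os(k := Suc (os k))) F + 2 * of_nat (os k) * gen_wronskian N os F
        - row_det N (?g(k := \<lambda>j. (2 * of_nat (a j)) * ?g k j)))"
    by (intro sum.cong) auto
  also have "\<dots> = two_x * (\<Sum>k<N. gen_wronskian N (os(k := Suc (os k))) F)
      + (\<Sum>k<N. 2 * of_nat (os k)) * gen_wronskian N os F
      - (\<Sum>k<N. row_det N (?g(k := \<lambda>j. (2 * of_nat (a j)) * ?g k j)))"
    by (simp only: sum.distrib sum_subtractf sum_distrib_left sum_distrib_right)
  also have "\<dots> = two_x * pderiv (gen_wronskian N os F)
      + 2 * of_nat (\<Sum>k<N. os k) * gen_wronskian N os F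
      - 2 * of_nat (\<Sum>j<N. a j) * gen_wronskian N os F"
    by (simp only: row_det_trace pderiv_gen_wronskian sum_distrib_left of_nat_sum)
      (simp only: gen_wronskian_def)
  finally show ?thesis
    by (simp only: left_diff_distrib right_diff_distrib add_diff_eq)
qed

text \<open>Raising the order of any row but the last repeats the order of the row below it.\<close>

lemma wronskian_first_deriv:
  "pderiv (gen_wronskian (Suc (Suc M)) (\<lambda>i. i) F) =
     gen_wronskian (Suc (Suc M)) ((\<lambda>i. i)(Suc M := Suc (Suc M))) F"
proof -
  have "gen_wronskian (Suc (Suc M)) ((\<lambda>i. i)(k := Suc k)) F = 0" if "k < Suc M" for k
    using that by (intro gen_wronskian_equal_orders[of k _ "Suc k"]) auto
  then show ?thesis by (simp add: pderiv_gen_wronskian)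
qed

lemma wronskian_second_deriv:
  "pderiv (pderiv (gen_wronskian (Suc (Suc M)) (\<lambda>i. i) F)) =
     gen_wronskian (Suc (Suc M)) ((\<lambda>i. i)(Suc M := Suc (Suc (Suc M)))) F
     + gen_wronskian (Suc (Suc M)) ((\<lambda>i. i)(M := Suc M, Suc M := Suc (Suc M))) F"
proof -
  let ?o = "(\<lambda>i. i)(Suc M := Suc (Suc M))"
  have "gen_wronskian (Suc (Suc M)) (?o(k := Suc (?o k))) F = 0" if "k < M" for k
    using that by (intro gen_wronskian_equal_orders[of k _ "Suc k"]) auto
  then have "pderiv (gen_wronskian (Suc (Suc M)) ?o F) =
      gen_wronskian (Suc (Suc M)) (?o(M := Suc (?o M))) F
      + gen_wronskian (Suc (Suc M)) (?o(Suc M := Suc (?o (Suc M)))) F"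
    by (simp add: pderiv_gen_wronskian del: fun_upd_apply)
  then show ?thesis
    by (simp add: wronskian_first_deriv fun_upd_twist[of "Suc M"] add.commute)
qed

text \<open>The second derivative of \<open>W\<close> is the sum of the two determinants on the
  left, and the trace identity yields their difference. Together they express each of the two
  through \<open>W\<close> and its first two derivatives.\<close>

lemma wronskian_trace:
  fixes F :: "nat \<Rightarrow> complex poly"
  assumes ode: "\<And>j. j < Suc (Suc M) \<Longrightarrow>
    pderiv (pderiv (F j)) = two_x * pderiv (F j) - 2 * of_nat (a j) * F j"
  defines "W \<equiv> gen_wronskian (Suc (Suc M)) (\<lambda>i. i) F"
  shows "gen_wronskian (Suc (Suc M)) ((\<lambda>i. i)(Suc M := Suc (Suc (Suc M)))) F
     - gen_wronskian (Suc (Suc M)) ((\<lambda>i. i)(M := Suc M, Suc M := Suc (Suc M))) F =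
     two_x * pderiv W
     + 2 * (of_nat (\<Sum>k<Suc (Suc M). k) - of_nat (\<Sum>j<Suc (Suc M). a j)) * W"
proof -
  let ?N = "Suc (Suc M)"
  have "gen_wronskian ?N ((\<lambda>i. i)(k := Suc (Suc k))) F = 0" if "k < M" for k
    using that by (intro gen_wronskian_equal_orders[of k _ "Suc (Suc k)"]) auto
  \<comment> \<open>Raising row \<open>M\<close> by two puts order \<open>M + 2\<close> above the
    last row of order \<open>M + 1\<close>; exchanging these rows produces the minus sign.\<close>
  moreover have "gen_wronskian ?N ((\<lambda>i. i)(M := Suc (Suc M))) F =
      - gen_wronskian ?N ((\<lambda>i. i)(M := Suc M, Suc M := Suc (Suc M))) F"
  proof -
    have "gen_wronskian ?N ((\<lambda>i. i)(M := Suc (Suc M), Suc M := Suc M)) F =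
        - gen_wronskian ?N ((\<lambda>i. i)(M := Suc M, Suc M := Suc (Suc M))) F"
      unfolding gen_wronskian_upd2 by (rule row_det_swap) auto
    moreover have "(\<lambda>i. i)(M := Suc (Suc M), Suc M := Suc M) = (\<lambda>i. i)(M := Suc (Suc M))"
      by auto
    ultimately show ?thesis by simp
  qed
  ultimately have "(\<Sum>k<?N. gen_wronskian ?N ((\<lambda>i. i)(k := Suc (Suc k))) F) =
      gen_wronskian ?N ((\<lambda>i. i)(Suc M := Suc (Suc (Suc M)))) F
     - gen_wronskian ?N ((\<lambda>i. i)(M := Suc M, Suc M := Suc (Suc M))) F"
    by (simp del: fun_upd_apply)
  moreover have "(\<Sum>k<?N. gen_wronskian ?N ((\<lambda>i. i)(k := Suc (Suc k))) F) =
      two_x * pderiv W + 2 * (of_nat (\<Sum>k<?N. k) - of_nat (\<Sum>j<?N. a j)) * W"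
    unfolding W_def by (rule gen_wronskian_trace) (rule ode)
  ultimately show ?thesis by (simp only:)
qed

lemma gen_wronskian_extend_unit:
  "row_det (Suc (Suc M)) ((\<lambda>i j. (pderiv ^^ i) (F j))
      (M := \<lambda>j. (pderiv ^^ l) (F j), Suc M := \<lambda>j. if j = Suc M then 1 else 0)) =
    gen_wronskian (Suc M) ((\<lambda>i. i)(M := l)) F"
  by (subst row_det_last_unit_row) (auto simp: gen_wronskian_upd intro!: row_det_cong)

text \<open>The row relation with the derivatives of orders \<open>M\<close>, \<open>M + 1\<close>,
  \<open>M + 2\<close> as first three rows and a unit row as the fourth. A determinant containing
  the unit row loses the last function and becomes a Wronskian of the first \<open>M + 1\<close>
  functions.\<close>

lemma wronskian_pluecker:
  fixes F :: "nat \<Rightarrow> 'a::idom poly"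
  shows "gen_wronskian (Suc (Suc M)) (\<lambda>i. i) F * gen_wronskian (Suc M) ((\<lambda>i. i)(M := Suc (Suc M))) F
    - gen_wronskian (Suc (Suc M)) ((\<lambda>i. i)(Suc M := Suc (Suc M))) F
      * gen_wronskian (Suc M) ((\<lambda>i. i)(M := Suc M)) F
    + gen_wronskian (Suc M) (\<lambda>i. i) F
      * gen_wronskian (Suc (Suc M)) ((\<lambda>i. i)(M := Suc M, Suc M := Suc (Suc M))) F = 0"
proof -
  let ?g = "\<lambda>i j. (pderiv ^^ i) (F j)"
  let ?e = "\<lambda>j. if j = Suc M then 1 else 0 :: 'a poly"
  have id: "(\<lambda>i. i)(M := M, Suc M := l) = (\<lambda>i. i)(Suc M := l)" for l :: nat by auto
  have id': "(\<lambda>i. i)(M := M) = (\<lambda>i. i)" "(\<lambda>i. i)(Suc M := Suc M) = (\<lambda>i. i)" by auto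
  have D: "row_det (Suc (Suc M)) (?g(M := ?g k, Suc M := ?e)) =
      gen_wronskian (Suc M) ((\<lambda>i. i)(M := k)) F" for k
    by (rule gen_wronskian_extend_unit)
  show ?thesis
    using row_det_pluecker[of M ?g "?g M" "?g (Suc M)" "?g (Suc (Suc M))" ?e]
    unfolding gen_wronskian_upd2[symmetric] D id id' .
qed

theorem wronskian_ode:
  fixes F :: "nat \<Rightarrow> complex poly" and M :: nat
  assumes ode: "\<And>j. j \<le> Suc (Suc M) \<Longrightarrow>
    pderiv (pderiv (F j)) = two_x * pderiv (F j) - 2 * of_nat (a j) * F j"
  defines "r \<equiv> Suc (Suc M)"
  defines "H \<equiv> gen_wronskian r (\<lambda>i. i) F" and "P \<equiv> gen_wronskian (Suc r) (\<lambda>i. i) F"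
  shows "H * pderiv (pderiv P) - two_x * H * pderiv P - 2 * pderiv H * pderiv P
    + pderiv (pderiv H) * P + two_x * pderiv H * P + 2 * (of_nat (a r) - of_nat r) * H * P = 0"
proof -
  define H2 where "H2 = gen_wronskian r ((\<lambda>i. i)(Suc M := Suc r)) F"
  define P2 where "P2 = gen_wronskian (Suc r) ((\<lambda>i. i)(Suc M := r, r := Suc r)) F"
  define s where "s = (of_nat (\<Sum>k<r. k) - of_nat (\<Sum>j<r. a j) :: complex poly)"
  have H'': "pderiv (pderiv H) = 2 * H2 - two_x * pderiv H - 2 * s * H"
    using wronskian_trace[of M F a] wronskian_second_deriv[of M F] ode
    by (simp add: H_def H2_def r_def s_def algebra_simps)
  have P'': "pderiv (pderiv P) = 2 * P2 + two_x * pderiv P + 2 * (s + of_nat r - of_nat (a r)) * P"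
    using wronskian_trace[of "Suc M" F a] wronskian_second_deriv[of "Suc M" F] ode
    by (simp add: P_def P2_def r_def s_def algebra_simps)
  have pl: "P * H2 - pderiv P * pderiv H + H * P2 = 0"
    using wronskian_pluecker[of "Suc M" F]
    by (simp add: H_def P_def H2_def P2_def r_def wronskian_first_deriv)
  \<comment> \<open>Once the second derivatives are eliminated, all terms in \<open>x\<close>,
    \<open>s\<close>, \<open>c\<close> and \<open>d\<close> cancel and twice the Pluecker relation
    remains.\<close>
  have "h * p'' - x * h * p' - 2 * h' * p' + h'' * p + x * h' * p + 2 * (c - d) * h * p =
      2 * (p * h2 - p' * h' + h * p2)"
    if "h'' = 2 * h2 - x * h' - 2 * s * h" "p'' = 2 * p2 + x * p' + 2 * (s + d - c) * p"
    for h h' h'' h2 p p' p'' p2 x s c d :: "complex poly"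
    unfolding that by (simp add: algebra_simps)
  from this[OF H'' P''] pl show ?thesis by (simp only:) simp
qed

section \<open>The differential equation of the Hermite polynomials\<close>

lemma smult_numeral_of_nat: "smult (2 * of_nat n) p = 2 * of_nat n * (p :: complex poly)"
proof -
  have "2 * of_nat n = [:2 * of_nat n :: complex:]"
    by (simp add: of_nat_poly numeral_poly)
  then show ?thesis by simp
qed

lemma hermite_recurrence:
  "hermite (Suc (Suc j)) = two_x * hermite (Suc j) - 2 * of_nat (Suc j) * hermite j"
  unfolding hermite.simps smult_numeral_of_nat two_x_def ..

lemma pderiv_numeral_of_nat_mult:
  "pderiv (2 * of_nat k * f :: complex poly) = 2 * of_nat k * pderiv f"
  by (simp only: smult_numeral_of_nat[symmetric] pderiv_smult)

lemma pderiv_hermite_Suc: "pderiv (hermite (Suc k)) = 2 * of_nat (Suc k) * hermite k"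
proof (induction k rule: less_induct)
  case (less k)
  show ?case
  proof (cases k)
    case 0
    then show ?thesis using pderiv_two_x by (simp add: two_x_def)
  next
    case (Suc j)
    have IH: "pderiv (hermite (Suc j)) = 2 * of_nat (Suc j) * hermite j"
      using less Suc by simp
    have h: "two_x * hermite j - pderiv (hermite j) = hermite (Suc j)"
    proof (cases j)
      case 0
      then show ?thesis by (simp add: two_x_def)
    next
      case (Suc i)
      then show ?thesis using less[of i] \<open>k = Suc j\<close>
        by (simp only: hermite_recurrence)
    qed
    have "pderiv (hermite (Suc k)) = 2 * hermite (Suc j)
        + two_x * (2 * of_nat (Suc j) * hermite j) - 2 * of_nat (Suc j) * pderiv (hermite j)"
      unfolding Suc hermite_recurrence pderiv_diff pderiv_mult[of two_x] pderiv_two_x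
        pderiv_numeral_of_nat_mult IH by (simp only: add.commute mult.commute)
    also have "\<dots> = 2 * hermite (Suc j) + 2 * of_nat (Suc j) * (two_x * hermite j - pderiv (hermite j))"
      by (simp only: right_diff_distrib mult.left_commute add_diff_eq)
    also have "\<dots> = 2 * of_nat (Suc k) * hermite k"
      unfolding h Suc by (simp add: algebra_simps)
    finally show ?thesis .
  qed
qed

lemma hermite_Suc: "hermite (Suc k) = two_x * hermite k - pderiv (hermite k)"
proof (cases k)
  case 0
  then show ?thesis by (simp add: two_x_def)
next
  case (Suc j)
  then show ?thesis by (simp only: hermite_recurrence pderiv_hermite_Suc)
qed

lemma hermite_ode:
  "pderiv (pderiv (hermite k)) = two_x * pderiv (hermite k) - 2 * of_nat k * hermite k"
proof (cases k)
  case (Suc j)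
  then show ?thesis
    unfolding Suc pderiv_hermite_Suc pderiv_numeral_of_nat_mult
    by (simp only: hermite_Suc right_diff_distrib mult.left_commute) simp
qed simp

subsection \<open>Zeros of the polynomials\<close>

lemma degree_higher_pderiv:
  fixes f :: "'a::{idom,semiring_char_0} poly"
  shows "degree ((pderiv ^^ i) f) = degree f - i"
  by (induction i) (simp_all add: degree_pderiv)

lemma higher_pderiv_eq_0:
  fixes f :: "'a::{idom,semiring_char_0} poly"
  assumes "degree f < i"
  shows "(pderiv ^^ i) f = 0"
proof -
  obtain k where k: "i = Suc k" "degree f \<le> k"
    using assms by (cases i) auto
  then have "degree ((pderiv ^^ k) f) = 0" by (simp add: degree_higher_pderiv)
  then show ?thesis using k by (simp add: pderiv_eq_0_iff)
qed

text \<open>Every Leibniz term is bounded by the same number. The case distinction is due to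
  truncated subtraction: if some order exceeds the degree of its function, the term is zero;
  otherwise all differences are genuine and may be summed.\<close>

lemma degree_gen_wronskian:
  fixes F :: "nat \<Rightarrow> 'a::{idom,semiring_char_0} poly"
  assumes "\<And>j. j < N \<Longrightarrow> degree (F j) \<le> d j"
  shows "degree (gen_wronskian N (\<lambda>i. i) F) \<le> (\<Sum>j<N. d j) - (\<Sum>i<N. i)"
  unfolding gen_wronskian_def row_det_leibniz
proof (rule degree_sum_le)
  show "finite {p. p permutes {0..<N}}" by (rule finite_permutations) simp
  fix p assume "p \<in> {p. p permutes {0..<N}}"
  then have p: "p permutes {0..<N}" by simp
  let ?f = "\<lambda>i. (pderiv ^^ i) (F (p i))"
  have "degree (\<Prod>i = 0..<N. ?f i) \<le> (\<Sum>j<N. d j) - (\<Sum>i<N. i)"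
  proof (cases "\<forall>i<N. i \<le> degree (F (p i))")
    case True
    have le: "degree (F (p i)) \<le> d (p i)" if "i < N" for i
      using assms[of "p i"] permutes_in_image[OF p, of i] that by simp
    have "degree (\<Prod>i = 0..<N. ?f i) \<le> (\<Sum>i = 0..<N. degree (?f i))"
      using degree_prod_sum_le[of "{0..<N}" ?f] by (simp add: comp_def)
    also have "\<dots> \<le> (\<Sum>i = 0..<N. d (p i) - i)"
      by (intro sum_mono) (simp add: degree_higher_pderiv diff_le_mono le)
    also have "\<dots> = (\<Sum>i = 0..<N. d (p i)) - (\<Sum>i = 0..<N. i)"
      using True le by (intro sum_subtractf_nat) (force intro: order_trans)
    also have "(\<Sum>i = 0..<N. d (p i)) = (\<Sum>j<N. d j)"
      using sum.permute[OF p, of d] by (simp add: lessThan_atLeast0 comp_def)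
    finally show ?thesis by (simp add: lessThan_atLeast0)
  next
    case False
    then obtain i where "i < N" "?f i = 0"
      by (auto simp: not_le intro: higher_pderiv_eq_0)
    then have "(\<Prod>i = 0..<N. ?f i) = 0" by (intro prod_zero) auto
    then show ?thesis by (simp only: degree_0)
  qed
  then show "degree (signof p * (\<Prod>i = 0..<N. ?f i)) \<le> (\<Sum>j<N. d j) - (\<Sum>i<N. i)"
    by (simp add: sign_def)
qed

text \<open>Introduced to show that the non-real zeros of \<open>exc_hermite lam n\<close> are
  closed under conjugation.\<close>

definition real_coeffs :: "complex poly \<Rightarrow> bool" where
  "real_coeffs p \<longleftrightarrow> (\<forall>i. coeff p i \<in> \<real>)"

lemma real_coeffs_closed:
  "real_coeffs 0" "real_coeffs 1"
  "real_coeffs p \<Longrightarrow> real_coeffs (pderiv p)"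
  "real_coeffs p \<Longrightarrow> real_coeffs (- p)"
  "real_coeffs p \<Longrightarrow> real_coeffs q \<Longrightarrow> real_coeffs (p + q)"
  "real_coeffs p \<Longrightarrow> real_coeffs q \<Longrightarrow> real_coeffs (p - q)"
  "real_coeffs p \<Longrightarrow> real_coeffs q \<Longrightarrow> real_coeffs (p * q)"
  by (auto simp: real_coeffs_def coeff_mult coeff_pderiv coeff_1
      intro!: sum_in_Reals Reals_mult Reals_add Reals_diff)

lemma real_coeffs_sum: "(\<And>i. i \<in> I \<Longrightarrow> real_coeffs (f i)) \<Longrightarrow> real_coeffs (sum f I)"
  by (induction I rule: infinite_finite_induct) (auto intro: real_coeffs_closed)

lemma real_coeffs_prod: "(\<And>i. i \<in> I \<Longrightarrow> real_coeffs (f i)) \<Longrightarrow> real_coeffs (prod f I)"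
  by (induction I rule: infinite_finite_induct) (auto intro: real_coeffs_closed)

lemma real_coeffs_hermite: "real_coeffs (hermite k)"
proof (induction k)
  case (Suc k)
  have "coeff two_x i \<in> \<real>" for i
    by (auto simp: two_x_def coeff_pCons split: nat.split)
  then show ?case
    unfolding hermite_Suc by (intro real_coeffs_closed Suc) (simp add: real_coeffs_def)
qed (simp add: real_coeffs_closed)

lemma real_coeffs_gen_wronskian:
  assumes "\<And>j. j < N \<Longrightarrow> real_coeffs (F j)"
  shows "real_coeffs (gen_wronskian N os F)"
  unfolding gen_wronskian_def row_det_leibniz
proof (intro real_coeffs_sum)
  fix p assume "p \<in> {p. p permutes {0..<N}}"
  then have p: "p permutes {0..<N}" by simp
  have "real_coeffs ((pderiv ^^ k) f)" if "real_coeffs f" for k f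
    using that by (induction k) (auto intro: real_coeffs_closed)
  then have "real_coeffs (\<Prod>i = 0..<N. (pderiv ^^ os i) (F (p i)))"
    using permutes_in_image[OF p] assms by (intro real_coeffs_prod) auto
  then show "real_coeffs (signof p * (\<Prod>i = 0..<N. (pderiv ^^ os i) (F (p i))))"
    by (auto simp: sign_def intro: real_coeffs_closed)
qed

text \<open>The index \<open>n + length lam\<close> follows those of the partition, so that both
  polynomials are Wronskians of initial segments of one sequence of functions, as
  \<open>wronskian_ode\<close> requires.\<close>

definition hermite_index :: "nat list \<Rightarrow> nat \<Rightarrow> nat \<Rightarrow> nat" where
  "hermite_index lam n j = (if j < length lam then rev lam ! j + j else n + length lam)"

lemma gen_hermite_eq:
  "gen_hermite lam = gen_wronskian (length lam) (\<lambda>i. i) (\<lambda>j. hermite (hermite_index lam n j))"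
proof -
  have "gen_hermite lam = gen_wronskian (length lam) (\<lambda>i. i) (\<lambda>j. hermite_seq lam ! j)"
    by (simp add: gen_hermite_def wronskian_eq_gen_wronskian hermite_seq_def)
  also have "\<dots> = gen_wronskian (length lam) (\<lambda>i. i) (\<lambda>j. hermite (hermite_index lam n j))"
    unfolding gen_wronskian_def
    by (intro row_det_cong) (simp add: hermite_seq_def hermite_index_def)
  finally show ?thesis .
qed

lemma exc_hermite_eq:
  "exc_hermite lam n =
     gen_wronskian (Suc (length lam)) (\<lambda>i. i) (\<lambda>j. hermite (hermite_index lam n j))"
proof -
  have "exc_hermite lam n = gen_wronskian (Suc (length lam)) (\<lambda>i. i)
      (\<lambda>j. (hermite_seq lam @ [hermite (n + length lam)]) ! j)"
    by (simp add: exc_hermite_def wronskian_eq_gen_wronskian hermite_seq_def)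
  also have "\<dots> = gen_wronskian (Suc (length lam)) (\<lambda>i. i) (\<lambda>j. hermite (hermite_index lam n j))"
    unfolding gen_wronskian_def
    by (intro row_det_cong) (auto simp: hermite_seq_def hermite_index_def nth_append)
  finally show ?thesis .
qed

lemma degree_hermite: "degree (hermite k) \<le> k"
proof (induction k)
  case (Suc k)
  have "degree (two_x * hermite k) \<le> Suc k"
    using Suc degree_mult_le[of two_x "hermite k"] by (simp add: two_x_def)
  then show ?case
    unfolding hermite_Suc using Suc
    by (intro degree_diff_le) (auto simp: degree_pderiv)
qed simp

lemma sum_hermite_index:
  "(\<Sum>j<length lam. hermite_index lam n j) = sum_list lam + (\<Sum>j<length lam. j)"
proof -
  have "(\<Sum>j<length lam. rev lam ! j) = sum_list lam"
    using sum_list_sum_nth[of "rev lam"] by (simp add: lessThan_atLeast0)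
  then show ?thesis by (simp add: hermite_index_def sum.distrib)
qed

lemma degree_gen_hermite: "degree (gen_hermite lam) \<le> sum_list lam"
  using degree_gen_wronskian[of "length lam" "\<lambda>j. hermite (hermite_index lam 0 j)" "hermite_index lam 0"]
  by (simp add: degree_hermite gen_hermite_eq[of lam 0] sum_hermite_index)

lemma degree_exc_hermite: "degree (exc_hermite lam n) \<le> sum_list lam + n"
  using degree_gen_wronskian[of "Suc (length lam)" "\<lambda>j. hermite (hermite_index lam n j)" "hermite_index lam n"]
  by (simp add: degree_hermite exc_hermite_eq sum_hermite_index)
    (simp add: hermite_index_def)

lemma real_coeffs_exc_hermite: "real_coeffs (exc_hermite lam n)"
  by (simp add: exc_hermite_eq real_coeffs_gen_wronskian real_coeffs_hermite)

text \<open>An even length is either 0, where the equation is that of the classical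
  \<open>hermite n\<close>, or at least 2, the range of \<open>wronskian_ode\<close>.\<close>

lemma exc_hermite_ode:
  fixes lam :: "nat list" and n :: nat
  assumes "even (length lam)"
  defines "H \<equiv> gen_hermite lam" and "P \<equiv> exc_hermite lam n"
  shows "H * pderiv (pderiv P) - two_x * H * pderiv P - 2 * pderiv H * pderiv P
    + pderiv (pderiv H) * P + two_x * pderiv H * P + 2 * of_nat n * H * P = 0"
proof (cases "length lam")
  case 0
  then have "lam = []" by simp
  then have "H = 1"
    by (simp add: H_def gen_hermite_def wronskian_def hermite_seq_def)
  moreover have "P = hermite n"
    using \<open>lam = []\<close> by (simp add: P_def exc_hermite_def wronskian_def hermite_seq_def det_single)
  ultimately show ?thesis by (simp add: hermite_ode)
next
  case (Suc M')
  then obtain M where M: "length lam = Suc (Suc M)"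
    using assms(1) by (cases M') auto
  have a: "of_nat (hermite_index lam n (Suc (Suc M))) - of_nat (Suc (Suc M)) = (of_nat n :: complex poly)"
    by (simp add: hermite_index_def M)
  show ?thesis
    using wronskian_ode[of M "\<lambda>j. hermite (hermite_index lam n j)" "hermite_index lam n", OF hermite_ode]
    unfolding H_def P_def gen_hermite_eq[of lam n] exc_hermite_eq M a .
qed

text \<open>Divide out one root at a time. An upper bound on the degree suffices because the roots
  are distinct, so the leading coefficient of a Wronskian need not be computed.\<close>

lemma poly_eq_prod_roots:
  fixes p :: "'a::idom poly"
  assumes "finite I" "inj_on \<zeta> I" "\<And>i. i \<in> I \<Longrightarrow> poly p (\<zeta> i) = 0" "degree p \<le> card I" "p \<noteq> 0"
  shows "\<exists>c. c \<noteq> 0 \<and> p = smult c (\<Prod>i\<in>I. [:- \<zeta> i, 1:])"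
  using assms
proof (induction I arbitrary: p rule: finite_induct)
  case empty
  then have "degree p = 0" by simp
  then obtain c where "p = [:c:]" by (rule degree_eq_zeroE)
  then show ?case using empty by (intro exI[of _ c]) simp
next
  case (insert i I)
  obtain q where q: "p = [:- \<zeta> i, 1:] * q"
    using insert.prems(2)[of i] by (auto simp: poly_eq_0_iff_dvd)
  have "q \<noteq> 0" using q insert.prems by auto
  then have "degree p = Suc (degree q)"
    using q by (simp add: degree_mult_eq del: mult_pCons_left)
  moreover have "poly q (\<zeta> k) = 0" if "k \<in> I" for k
  proof -
    have "\<zeta> k \<noteq> \<zeta> i" using insert.prems(1) insert.hyps that by (auto simp: inj_on_def)
    then show ?thesis using insert.prems(2)[of k] that q by auto
  qed
  ultimately obtain c where "c \<noteq> 0" "q = smult c (\<Prod>i\<in>I. [:- \<zeta> i, 1:])"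
    using insert.IH[of q] insert.prems insert.hyps \<open>q \<noteq> 0\<close> by auto
  then show ?case using insert.hyps q by (auto simp: mult_smult_right simp del: mult_pCons_left)
qed

text \<open>The logarithmic derivative of \<open>q\<close> is \<open>s\<close>; the quotient of the
  second derivative by \<open>q\<close> is the square of \<open>s\<close> plus the derivative of
  \<open>s\<close>.\<close>

lemma poly_derivs_prod_roots:
  fixes \<zeta> :: "'i \<Rightarrow> 'a::field" and I :: "'i set" and u :: 'a
  assumes "finite I" "\<And>i. i \<in> I \<Longrightarrow> u \<noteq> \<zeta> i"
  defines "q \<equiv> \<Prod>i\<in>I. [:- \<zeta> i, 1:]"
  defines "s \<equiv> \<Sum>i\<in>I. 1 / (u - \<zeta> i)"
  shows "poly (pderiv q) u = poly q u * s"
    and "poly (pderiv (pderiv q)) u = poly q u * (s\<^sup>2 - (\<Sum>i\<in>I. 1 / (u - \<zeta> i)\<^sup>2))"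
proof -
  have "poly (pderiv (\<Prod>i\<in>I. [:- \<zeta> i, 1:])) u = poly (\<Prod>i\<in>I. [:- \<zeta> i, 1:]) u * (\<Sum>i\<in>I. 1 / (u - \<zeta> i)) \<and>
    poly (pderiv (pderiv (\<Prod>i\<in>I. [:- \<zeta> i, 1:]))) u = poly (\<Prod>i\<in>I. [:- \<zeta> i, 1:]) u *
      ((\<Sum>i\<in>I. 1 / (u - \<zeta> i))\<^sup>2 - (\<Sum>i\<in>I. 1 / (u - \<zeta> i)\<^sup>2))"
    using assms(1,2)
  proof (induction I rule: finite_induct)
    case (insert i I)
    let ?q = "\<Prod>i\<in>I. [:- \<zeta> i, 1:]" and ?s = "\<Sum>i\<in>I. 1 / (u - \<zeta> i)"
    have ne: "u - \<zeta> i \<noteq> 0" using insert.prems by simp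
    have rec: "e * (Q * (s\<^sup>2 - t)) + 2 * (Q * s) = e * Q * ((1 / e + s)\<^sup>2 - (1 / e\<^sup>2 + t))"
      if "e \<noteq> 0" for e Q s t :: 'a
      using that by (simp add: power2_sum power_divide ring_distribs)
    have lin: "poly [:- \<zeta> i, 1:] u = u - \<zeta> i" "poly 2 u = 2" by simp_all
    have d: "pderiv [:- \<zeta> i, 1:] = 1" by (simp add: pderiv_pCons)
    have q': "pderiv ([:- \<zeta> i, 1:] * ?q) = [:- \<zeta> i, 1:] * pderiv ?q + ?q"
      by (simp only: pderiv_mult d) simp
    have IH: "poly (pderiv ?q) u = poly ?q u * ?s"
      "poly (pderiv (pderiv ?q)) u = poly ?q u * (?s\<^sup>2 - (\<Sum>i\<in>I. 1 / (u - \<zeta> i)\<^sup>2))"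
      using insert.IH insert.prems by auto
    have "poly (pderiv (\<Prod>i\<in>insert i I. [:- \<zeta> i, 1:])) u =
        poly (\<Prod>i\<in>insert i I. [:- \<zeta> i, 1:]) u * (\<Sum>i\<in>insert i I. 1 / (u - \<zeta> i))"
      using ne
      by (simp only: prod.insert[OF insert.hyps] sum.insert[OF insert.hyps] q' poly_add poly_mult IH) (simp add: field_simps)
    moreover have "pderiv (pderiv ([:- \<zeta> i, 1:] * ?q)) = [:- \<zeta> i, 1:] * pderiv (pderiv ?q) + 2 * pderiv ?q"
      by (simp only: q' pderiv_mult d pderiv_add) simp
    then have "poly (pderiv (pderiv (\<Prod>i\<in>insert i I. [:- \<zeta> i, 1:]))) u =
        poly (\<Prod>i\<in>insert i I. [:- \<zeta> i, 1:]) u * ((\<Sum>i\<in>insert i I. 1 / (u - \<zeta> i))\<^sup>2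
          - (\<Sum>i\<in>insert i I. 1 / (u - \<zeta> i)\<^sup>2))"
      by (simp only: prod.insert[OF insert.hyps] sum.insert[OF insert.hyps] poly_add poly_mult IH
          lin rec[OF ne])
    ultimately show ?case ..
  qed simp
  then show "poly (pderiv q) u = poly q u * s"
    and "poly (pderiv (pderiv q)) u = poly q u * (s\<^sup>2 - (\<Sum>i\<in>I. 1 / (u - \<zeta> i)\<^sup>2))"
    by (auto simp: q_def s_def)
qed

lemma pderiv_linear_mult_at_root:
  fixes q :: "'a::field poly" and y :: 'a
  defines "p \<equiv> [:- y, 1:] * q"
  shows "poly (pderiv p) y = poly q y"
    and "poly (pderiv (pderiv p)) y = 2 * poly (pderiv q) y"
    and "poly (pderiv (pderiv (pderiv p))) y = 3 * poly (pderiv (pderiv q)) y"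
proof -
  have d: "pderiv [:- y, 1:] = 1" by (simp add: pderiv_pCons)
  have 1: "pderiv p = [:- y, 1:] * pderiv q + q"
    unfolding p_def by (simp only: pderiv_mult d) simp
  have 2: "pderiv (pderiv p) = [:- y, 1:] * pderiv (pderiv q) + (pderiv q + pderiv q)"
    unfolding 1 by (simp only: pderiv_mult d pderiv_add) simp
  have 3: "pderiv (pderiv (pderiv p)) = [:- y, 1:] * pderiv (pderiv (pderiv q))
      + (pderiv (pderiv q) + pderiv (pderiv q) + pderiv (pderiv q))"
    unfolding 2 by (simp only: pderiv_mult d pderiv_add) simp
  show "poly (pderiv p) y = poly q y" unfolding 1 by simp
  show "poly (pderiv (pderiv p)) y = 2 * poly (pderiv q) y" unfolding 2 by simp
  show "poly (pderiv (pderiv (pderiv p))) y = 3 * poly (pderiv (pderiv q)) y" unfolding 3 by simp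
qed

text \<open>Stieltjes relations: the first line is the criticality of the zeros for the energy,
  the second follows by differentiating the equation once more.\<close>

lemma stieltjes_relations:
  fixes H P :: "complex poly" and w :: "'i \<Rightarrow> complex" and \<zeta> :: "'j \<Rightarrow> complex"
  assumes ode: "H * pderiv (pderiv P) - two_x * H * pderiv P - 2 * pderiv H * pderiv P
    + pderiv (pderiv H) * P + two_x * pderiv H * P + 2 * of_nat n * H * P = 0"
    and H: "H = smult c (\<Prod>k\<in>K. [:- w k, 1:])" "c \<noteq> 0" "finite K"
    and P: "P = smult d (\<Prod>i\<in>I. [:- \<zeta> i, 1:])" "d \<noteq> 0" "finite I" "inj_on \<zeta> I"
    and a: "a \<in> I" and ne: "poly H (\<zeta> a) \<noteq> 0"
  shows "(\<Sum>i\<in>I - {a}. 1 / (\<zeta> a - \<zeta> i)) = \<zeta> a + (\<Sum>k\<in>K. 1 / (\<zeta> a - w k))"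
    and "3 * (\<Sum>i\<in>I - {a}. 1 / (\<zeta> a - \<zeta> i)\<^sup>2) =
      2 * of_nat n - 2 + (\<Sum>k\<in>K. 1 / (\<zeta> a - w k)\<^sup>2) - (\<zeta> a)\<^sup>2"
proof -
  let ?y = "\<zeta> a"
  let ?S1 = "\<Sum>i\<in>I - {a}. 1 / (?y - \<zeta> i)" and ?S2 = "\<Sum>i\<in>I - {a}. 1 / (?y - \<zeta> i)\<^sup>2"
  let ?h = "\<Sum>k\<in>K. 1 / (?y - w k)" and ?T = "\<Sum>k\<in>K. 1 / (?y - w k)\<^sup>2"
  define Q where "Q = smult d (\<Prod>i\<in>I - {a}. [:- \<zeta> i, 1:])"
  have PQ: "P = [:- ?y, 1:] * Q"
    unfolding P(1) Q_def mult_smult_right using prod.remove[OF \<open>finite I\<close> a, of "\<lambda>i. [:- \<zeta> i, 1:]"]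
    by simp
  have ne': "?y \<noteq> \<zeta> i" if "i \<in> I - {a}" for i
    using that P(4) a by (auto dest: inj_onD)
  define q where "q = poly Q ?y"
  have "q \<noteq> 0"
    using ne' P by (auto simp: q_def Q_def poly_prod)
  have Q1: "poly (pderiv Q) ?y = q * ?S1"
    using poly_derivs_prod_roots(1)[of "I - {a}" ?y \<zeta>] P(3) ne'
    by (simp add: q_def Q_def pderiv_smult)
  have Q2: "poly (pderiv (pderiv Q)) ?y = q * (?S1\<^sup>2 - ?S2)"
    using poly_derivs_prod_roots(2)[of "I - {a}" ?y \<zeta>] P(3) ne'
    by (simp add: q_def Q_def pderiv_smult)
  have P0: "poly P ?y = 0" using PQ by simp
  note Pd = pderiv_linear_mult_at_root[of ?y Q, folded PQ q_def, unfolded Q1 Q2]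
  define h0 where "h0 = poly H ?y"
  have h0: "h0 \<noteq> 0" using ne by (simp add: h0_def)
  have new: "?y \<noteq> w k" if "k \<in> K" for k
    using ne that H by (auto simp: poly_prod)
  have H1: "poly (pderiv H) ?y = h0 * ?h"
    using poly_derivs_prod_roots(1)[of K ?y w] H(3) new
    by (simp add: h0_def H(1) pderiv_smult)
  have H2: "poly (pderiv (pderiv H)) ?y = h0 * (?h\<^sup>2 - ?T)"
    using poly_derivs_prod_roots(2)[of K ?y w] H(3) new
    by (simp add: h0_def H(1) pderiv_smult)
  have x: "poly two_x ?y = 2 * ?y" by (simp add: two_x_def)
  have E1: "h0 * (2 * (q * ?S1)) - 2 * ?y * h0 * q - 2 * (h0 * ?h) * q = 0"
    using arg_cong[OF ode, of "\<lambda>p. poly p ?y"]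
    by (simp add: Pd H1 H2 x P0 h0_def[symmetric])
  then have "2 * h0 * q * (?S1 - (?y + ?h)) = 0" by (simp add: algebra_simps)
  then show S1: "?S1 = ?y + ?h" using h0 \<open>q \<noteq> 0\<close> by simp
  have dn: "pderiv (of_nat n :: complex poly) = 0" by (simp add: pderiv_of_nat)
  have d2: "pderiv (2 :: complex poly) = 0" using pderiv_of_nat[of 2, where 'a = complex] by simp
  \<comment> \<open>The equation is differentiated once. The third derivative of \<open>H\<close>
    enters only as a factor of \<open>P\<close> and drops out at the zero, while the first three
    derivatives of \<open>P\<close> are \<open>q\<close>, \<open>2 * q * ?S1\<close> and
    \<open>3 * q * (?S1^2 - ?S2)\<close>.\<close>
  have E2: "(h0 * ?h) * (2 * (q * ?S1)) + h0 * (3 * (q * (?S1\<^sup>2 - ?S2)))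
      - 2 * h0 * q - 2 * ?y * (h0 * ?h) * q - 2 * ?y * h0 * (2 * (q * ?S1))
      - 2 * (h0 * (?h\<^sup>2 - ?T)) * q - 2 * (h0 * ?h) * (2 * (q * ?S1))
      + (h0 * (?h\<^sup>2 - ?T)) * q + 2 * ?y * (h0 * ?h) * q + 2 * of_nat n * h0 * q = 0"
    using arg_cong[OF ode, of "\<lambda>p. poly (pderiv p) ?y"]
    by (simp add: pderiv_add pderiv_diff pderiv_mult pderiv_two_x dn d2 Pd H1 H2 x P0 h0_def[symmetric]
          algebra_simps)
  have "h0 * q * (- 2 * ?h * ?S1 + 3 * (?S1\<^sup>2 - ?S2) - 2 - 4 * ?y * ?S1 - (?h\<^sup>2 - ?T) + 2 * of_nat n) = 0"
    using E2 by (simp add: algebra_simps)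
  then have "- 2 * ?h * ?S1 + 3 * (?S1\<^sup>2 - ?S2) - 2 - 4 * ?y * ?S1 - (?h\<^sup>2 - ?T) + 2 * of_nat n = 0"
    using h0 \<open>q \<noteq> 0\<close> by simp
  \<comment> \<open>Substituting the first relation for \<open>?S1\<close> cancels every term in
    \<open>?h\<close> and leaves only \<open>- ?y^2\<close>.\<close>
  then show "3 * ?S2 = 2 * of_nat n - 2 + ?T - ?y\<^sup>2"
    unfolding S1 by (simp add: algebra_simps power2_eq_square)
qed

text \<open>At a common zero the equation reduces to its term \<open>- 2 H' P'\<close>.\<close>

lemma no_common_simple_zero:
  fixes H P :: "complex poly"
  assumes ode: "H * pderiv (pderiv P) - two_x * H * pderiv P - 2 * pderiv H * pderiv P
    + pderiv (pderiv H) * P + two_x * pderiv H * P + 2 * of_nat n * H * P = 0"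
    and "poly P y = 0" "poly (pderiv P) y \<noteq> 0" "poly (pderiv H) y \<noteq> 0"
  shows "poly H y \<noteq> 0"
proof
  assume "poly H y = 0"
  then show False
    using arg_cong[OF ode, of "\<lambda>p. poly p y"] assms(2-) by simp
qed

lemma pderiv_nonzero_simple_root:
  fixes p :: "'a::field poly"
  assumes "p = smult d (\<Prod>i\<in>I. [:- \<zeta> i, 1:])" "d \<noteq> 0" "finite I" "inj_on \<zeta> I" "a \<in> I"
  shows "poly (pderiv p) (\<zeta> a) \<noteq> 0"
proof -
  have "p = [:- \<zeta> a, 1:] * smult d (\<Prod>i\<in>I - {a}. [:- \<zeta> i, 1:])"
    using prod.remove[of I a "\<lambda>i. [:- \<zeta> i, 1:]"] assms by (simp del: mult_pCons_left)
  then have "poly (pderiv p) (\<zeta> a) = poly (smult d (\<Prod>i\<in>I - {a}. [:- \<zeta> i, 1:])) (\<zeta> a)"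
    by (simp only: pderiv_linear_mult_at_root)
  then show ?thesis
    using assms by (auto simp: poly_prod dest: inj_onD)
qed

subsection \<open>The Hessian of the logarithmic energy\<close>

definition point_coord :: "nat \<Rightarrow> (nat \<Rightarrow> real) \<Rightarrow> nat \<Rightarrow> complex" where
  "point_coord m v a = (if a < m then exc_coord v a else complex_of_real (reg_coord m v (a - m)))"

text \<open>Each real coordinate moves exactly one of the \<open>m + n\<close> points, with velocity
  \<open>coord_dir m j\<close>. The coordinate \<open>2 * m + i\<close> belongs to the point
  \<open>m + i\<close>, hence the shift by \<open>m\<close>.\<close>

definition coord_owner :: "nat \<Rightarrow> nat \<Rightarrow> nat" where
  "coord_owner m j = (if j < 2 * m then j div 2 else j - m)"

definition coord_dir :: "nat \<Rightarrow> nat \<Rightarrow> complex" where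
  "coord_dir m j = (if j < 2 * m \<and> odd j then \<i> else 1)"

lemma point_coord_upd:
  "point_coord m (v(j := t)) a =
     point_coord m v a + of_real (t - v j) * (if coord_owner m j = a then coord_dir m j else 0)"
proof (cases "a < m")
  case True
  then show ?thesis
    by (auto simp: point_coord_def coord_owner_def coord_dir_def exc_coord_def complex_eq_iff elim!: oddE)
next
  case False
  then have "2 * m + (a - m) = m + a" by simp
  with False show ?thesis
    by (auto simp: point_coord_def coord_owner_def coord_dir_def reg_coord_def complex_eq_iff)
qed

lemma sum_add_lessThan:
  "(\<Sum>a<m + n. f a) = (\<Sum>a<m. f a) + (\<Sum>i<n. f (m + i :: nat) :: 'a::comm_monoid_add)"
  by (induction n) (auto simp: ac_simps)

text \<open>The three interaction sums run over the pairs inside and across the two groups, so they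
  merge into one sum over all pairs of points.\<close>

lemma log_energy_eq:
  "log_energy H m n v = (\<Sum>a<m + n. ln (weight H (point_coord m v a)))
     + (\<Sum>b<m + n. \<Sum>a<b. ln ((cmod (point_coord m v a - point_coord m v b))\<^sup>2))"
proof -
  let ?u = "point_coord m v"
  have "(\<Sum>b<m + n. \<Sum>a<b. ln ((cmod (?u a - ?u b))\<^sup>2)) =
      (\<Sum>b<m. \<Sum>a<b. ln ((cmod (?u a - ?u b))\<^sup>2))
      + (\<Sum>i<n. (\<Sum>a<m. ln ((cmod (?u a - ?u (m + i)))\<^sup>2))
          + (\<Sum>j<i. ln ((cmod (?u (m + j) - ?u (m + i)))\<^sup>2)))"
    by (simp add: sum_add_lessThan)
  also have "(\<Sum>i<n. (\<Sum>a<m. ln ((cmod (?u a - ?u (m + i)))\<^sup>2))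
          + (\<Sum>j<i. ln ((cmod (?u (m + j) - ?u (m + i)))\<^sup>2))) =
      (\<Sum>a<m. \<Sum>i<n. ln ((cmod (?u a - ?u (m + i)))\<^sup>2))
      + (\<Sum>i<n. \<Sum>j<i. ln ((cmod (?u (m + j) - ?u (m + i)))\<^sup>2))"
    unfolding sum.distrib by (subst sum.swap) simp
  moreover have "cmod (?u (m + j) - ?u (m + i)) = \<bar>reg_coord m v j - reg_coord m v i\<bar>" for i j
    by (simp add: point_coord_def flip: of_real_diff)
  moreover have "cmod (?u a - ?u (m + i)) = cmod (complex_of_real (reg_coord m v i) - exc_coord v a)"
    if "a < m" for a i
    using that by (simp add: point_coord_def norm_minus_commute)
  moreover have "(\<Sum>b<m. \<Sum>a<b. ln ((cmod (?u a - ?u b))\<^sup>2)) =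
      (\<Sum>l<m. \<Sum>k<l. ln ((cmod (exc_coord v k - exc_coord v l))\<^sup>2))"
    by (intro sum.cong refl) (simp add: point_coord_def)
  moreover have "(\<Sum>a<m + n. ln (weight H (?u a))) =
     (\<Sum>k<m. ln (weight H (exc_coord v k)))
   + (\<Sum>i<n. ln (weight H (complex_of_real (reg_coord m v i))))"
    by (simp add: sum_add_lessThan point_coord_def)
  ultimately show ?thesis
    by (simp add: log_energy_def)
qed

lemma sum_triangle_symmetric:
  fixes g :: "nat \<Rightarrow> nat \<Rightarrow> real"
  assumes "\<And>a b. g a b = g b a"
  shows "(\<Sum>b<N. \<Sum>a<b. g a b) = (\<Sum>a<N. \<Sum>b\<in>{..<N} - {a}. g a b) / 2"
proof (induction N)
  case (Suc N)
  have "(\<Sum>b\<in>{..<Suc N} - {a}. g a b) = (\<Sum>b\<in>{..<N} - {a}. g a b) + g a N" if "a < N" for a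
  proof -
    have "{..<Suc N} - {a} = insert N ({..<N} - {a})" using that by auto
    then show ?thesis by simp
  qed
  moreover have "{..<Suc N} - {N} = {..<N}" by auto
  moreover have "(\<Sum>b<N. g N b) = (\<Sum>a<N. g a N)"
    by (intro sum.cong refl assms)
  ultimately show ?case
    using Suc by (simp add: sum.distrib)
qed simp

lemma sum_off_diagonal_swap:
  fixes g :: "nat \<Rightarrow> nat \<Rightarrow> 'a::comm_monoid_add"
  shows "(\<Sum>a<N. \<Sum>b\<in>{..<N} - {a}. g a b) = (\<Sum>a<N. \<Sum>b\<in>{..<N} - {a}. g b a)"
proof -
  have full: "(\<Sum>a<N. \<Sum>b\<in>{..<N} - {a}. f a b) = (\<Sum>a<N. \<Sum>b<N. if a \<noteq> b then f a b else 0)" for f :: "nat \<Rightarrow> nat \<Rightarrow> 'a"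
    by (intro sum.cong refl sum.mono_neutral_cong_left) auto
  have "(\<Sum>a<N. \<Sum>b<N. if a \<noteq> b then g a b else 0) = (\<Sum>b<N. \<Sum>a<N. if a \<noteq> b then g a b else 0)"
    by (rule sum.swap)
  also have "\<dots> = (\<Sum>b<N. \<Sum>a<N. if b \<noteq> a then g a b else 0)"
    by (simp add: eq_commute)
  finally show ?thesis unfolding full .
qed

lemma DERIV_ln_cmod_sq:
  assumes "(U has_vector_derivative U') (at t)" "U t \<noteq> 0"
  shows "((\<lambda>t. ln ((cmod (U t))\<^sup>2)) has_real_derivative 2 * Re (U' / U t)) (at t)"
proof -
  have pos: "(cmod (U t))\<^sup>2 > 0" using assms by simp
  have "((\<lambda>t. ln ((Re (U t))\<^sup>2 + (Im (U t))\<^sup>2)) has_real_derivative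
      (2 * Re (U t) * Re U' + 2 * Im (U t) * Im U') / ((Re (U t))\<^sup>2 + (Im (U t))\<^sup>2)) (at t)"
    using pos by (auto intro!: derivative_eq_intros assms simp: cmod_power2)
  then show ?thesis
    by (simp add: cmod_power2 Re_divide add_divide_distrib algebra_simps)
qed

lemma DERIV_ln_weight:
  assumes U: "(U has_vector_derivative U') (at t)" and ne: "poly H (U t) \<noteq> 0"
  shows "((\<lambda>t. ln (weight H (U t))) has_real_derivative
    Re (U' * (- 2 * U t - 2 * (poly (pderiv H) (U t) / poly H (U t))))) (at t)"
proof -
  have HU: "((\<lambda>t. poly H (U t)) has_vector_derivative U' * poly (pderiv H) (U t)) (at t)"
    using field_vector_diff_chain_at[OF U, of "poly H"] by (simp add: o_def)
  have "((\<lambda>u. u\<^sup>2) has_field_derivative 2 * U t) (at (U t))"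
    by (auto intro!: derivative_eq_intros)
  from field_vector_diff_chain_at[OF U this]
  have "((\<lambda>t. (U t)\<^sup>2) has_vector_derivative U' * (2 * U t)) (at t)"
    by (simp add: o_def)
  from DERIV_diff[OF DERIV_minus[OF has_field_derivative_Re[OF this]] DERIV_ln_cmod_sq[OF HU ne]]
  have "((\<lambda>t. - Re ((U t)\<^sup>2) - ln ((cmod (poly H (U t)))\<^sup>2)) has_real_derivative
      - Re (U' * (2 * U t)) - 2 * Re (U' * poly (pderiv H) (U t) / poly H (U t))) (at t)"
    .
  also have "- Re (U' * (2 * U t)) - 2 * Re (U' * poly (pderiv H) (U t) / poly H (U t)) =
      Re (U' * (- 2 * U t - 2 * (poly (pderiv H) (U t) / poly H (U t))))"
  proof -
    have "- Re (x * (2 * y)) - 2 * Re (x * q) = Re (x * (- 2 * y - 2 * q))" for x y q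
      by (simp add: algebra_simps)
    from this[of U' "U t" "poly (pderiv H) (U t) / poly H (U t)"] show ?thesis
      by (simp only: times_divide_eq_right)
  qed
  finally have D: "((\<lambda>t. - Re ((U t)\<^sup>2) - ln ((cmod (poly H (U t)))\<^sup>2)) has_real_derivative
      Re (U' * (- 2 * U t - 2 * (poly (pderiv H) (U t) / poly H (U t))))) (at t)" .
  have "isCont (\<lambda>t. poly H (U t)) t"
    using HU by (rule has_vector_derivative_continuous)
  \<comment> \<open>The logarithm of the weight splits where \<open>H\<close> does not vanish, so
    the two functions are compared on a neighbourhood of \<open>t\<close>.\<close>
  then have "((\<lambda>t. poly H (U t)) \<longlongrightarrow> poly H (U t)) (nhds t)"
    by (simp add: isCont_def tendsto_nhds_iff)
  then have "eventually (\<lambda>s. poly H (U s) \<noteq> 0) (nhds t)"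
    using ne by (rule tendsto_imp_eventually_ne)
  then have "eventually (\<lambda>s. ln (weight H (U s)) = - Re ((U s)\<^sup>2) - ln ((cmod (poly H (U s)))\<^sup>2)) (nhds t)"
    by eventually_elim (simp add: weight_def ln_div)
  then show ?thesis
    using D by (subst DERIV_cong_ev[OF refl _ refl])
qed

definition nonsingular_point :: "complex poly \<Rightarrow> nat \<Rightarrow> nat \<Rightarrow> (nat \<Rightarrow> real) \<Rightarrow> bool" where
  "nonsingular_point H m n v \<longleftrightarrow>
     (\<forall>a<m + n. poly H (point_coord m v a) \<noteq> 0) \<and> inj_on (point_coord m v) {..<m + n}"

lemma point_coord_has_vector_derivative:
  "((\<lambda>t. point_coord m (v(j := t)) a) has_vector_derivative
      (if coord_owner m j = a then coord_dir m j else 0)) (at t)"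
  unfolding point_coord_upd by (auto intro!: derivative_eq_intros simp: has_vector_derivative_def scaleR_conv_of_real)

text \<open>A second partial derivative differentiates the formula for the first one, which must
  therefore hold along a whole neighbourhood of the point.\<close>

lemma eventually_nonsingular_point:
  assumes "nonsingular_point H m n v"
  shows "eventually (\<lambda>t. nonsingular_point H m n (v(j := t))) (nhds (v j))"
proof -
  let ?u = "\<lambda>t. point_coord m (v(j := t))"
  have lim: "((\<lambda>t. ?u t a) \<longlongrightarrow> point_coord m v a) (nhds (v j))" for a
    using has_vector_derivative_continuous[OF point_coord_has_vector_derivative[of m v j a "v j"]]
    by (simp add: isCont_def tendsto_nhds_iff del: fun_upd_apply)
  have "eventually (\<lambda>t. \<forall>a\<in>{..<m + n}. poly H (?u t a) \<noteq> 0) (nhds (v j))"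
    using assms
    by (auto simp: nonsingular_point_def intro!: eventually_ball_finite tendsto_imp_eventually_ne tendsto_poly lim)
  moreover have "eventually (\<lambda>t. \<forall>(a, b)\<in>{(a, b). a < m + n \<and> b < m + n \<and> a \<noteq> b}. ?u t a - ?u t b \<noteq> 0) (nhds (v j))"
  proof (intro eventually_ball_finite ballI)
    show "finite {(a, b). a < m + n \<and> b < m + n \<and> a \<noteq> b}"
      by (rule finite_subset[of _ "{..<m + n} \<times> {..<m + n}"]) auto
    fix ab assume "ab \<in> {(a, b). a < m + n \<and> b < m + n \<and> a \<noteq> b}"
    then obtain a b where ab: "ab = (a, b)" "a < m + n" "b < m + n" "a \<noteq> b" by auto
    then have "point_coord m v a - point_coord m v b \<noteq> 0"
      using assms by (auto simp: nonsingular_point_def dest: inj_onD)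
    with lim[of a] lim[of b] have "eventually (\<lambda>t. ?u t a - ?u t b \<noteq> 0) (nhds (v j))"
      by (intro tendsto_imp_eventually_ne[OF tendsto_diff])
    then show "eventually (\<lambda>t. case ab of (a, b) \<Rightarrow> ?u t a - ?u t b \<noteq> 0) (nhds (v j))"
      by (simp add: ab)
  qed
  ultimately show ?thesis
    by eventually_elim (auto simp: nonsingular_point_def inj_on_def)
qed

definition energy_force :: "complex poly \<Rightarrow> nat \<Rightarrow> nat \<Rightarrow> (nat \<Rightarrow> complex) \<Rightarrow> nat \<Rightarrow> complex" where
  "energy_force H m n u a = - 2 * u a - 2 * (poly (pderiv H) (u a) / poly H (u a))
     + 2 * (\<Sum>b\<in>{..<m + n} - {a}. 1 / (u a - u b))"

lemma partial_deriv_log_energy: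
  assumes ns: "nonsingular_point H m n v" and j: "coord_owner m j < m + n"
  shows "partial_deriv j (log_energy H m n) v =
    Re (coord_dir m j * energy_force H m n (point_coord m v) (coord_owner m j))"
proof -
  let ?N = "m + n" and ?u = "\<lambda>t. point_coord m (v(j := t))"
  define e where "e = (\<lambda>a. if coord_owner m j = a then coord_dir m j else 0)"
  define h where "h = (\<lambda>u. poly (pderiv H) u / poly H u)"
  have u: "((\<lambda>t. ?u t a) has_vector_derivative e a) (at t)" for a t
    unfolding e_def by (rule point_coord_has_vector_derivative)
  have u0: "?u (v j) = point_coord m v" by simp
  have ne: "poly H (?u (v j) a) \<noteq> 0" if "a < ?N" for a
    using ns that by (simp add: nonsingular_point_def)
  have ne': "?u (v j) a - ?u (v j) b \<noteq> 0" if "a < ?N" "b < ?N" "a \<noteq> b" for a b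
    using ns that by (auto simp: nonsingular_point_def dest: inj_onD)
  have LE: "log_energy H m n (v(j := t)) = (\<Sum>a<?N. ln (weight H (?u t a)))
     + (\<Sum>a<?N. \<Sum>b\<in>{..<?N} - {a}. ln ((cmod (?u t a - ?u t b))\<^sup>2)) / 2" for t
    unfolding log_energy_eq
    by (subst sum_triangle_symmetric) (auto simp: norm_minus_commute)
  have D: "((\<lambda>t. log_energy H m n (v(j := t))) has_real_derivative
      (\<Sum>a<?N. Re (e a * (- 2 * ?u (v j) a - 2 * h (?u (v j) a))))
      + (\<Sum>a<?N. \<Sum>b\<in>{..<?N} - {a}. 2 * Re ((e a - e b) / (?u (v j) a - ?u (v j) b))) / 2) (at (v j))"
    unfolding LE h_def
    by (intro DERIV_add DERIV_sum DERIV_cdivide DERIV_ln_weight DERIV_ln_cmod_sq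
        has_vector_derivative_diff u) (use ne ne' in \<open>simp_all del: fun_upd_apply\<close>)
  let ?p = "point_coord m v"
  let ?S = "\<lambda>a. \<Sum>b\<in>{..<?N} - {a}. 1 / (?p a - ?p b)"
  \<comment> \<open>Each term splits into two halves that are exchanged by renaming \<open>a\<close>
    and \<open>b\<close>; the sum over ordered pairs becomes twice a sum in which only the velocity
    of the first point enters.\<close>
  have "(x - y) / (p - q) = x / (p - q) + y / (q - p)" for x y p q :: complex
    using minus_divide_right[of y "p - q"] by (simp add: diff_divide_distrib)
  then have "(\<Sum>a<?N. \<Sum>b\<in>{..<?N} - {a}. (e a - e b) / (?p a - ?p b)) =
      (\<Sum>a<?N. \<Sum>b\<in>{..<?N} - {a}. e a / (?p a - ?p b))
      + (\<Sum>a<?N. \<Sum>b\<in>{..<?N} - {a}. e b / (?p b - ?p a))"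
    by (simp only: sum.distrib)
  also have "(\<Sum>a<?N. \<Sum>b\<in>{..<?N} - {a}. e b / (?p b - ?p a)) =
      (\<Sum>a<?N. \<Sum>b\<in>{..<?N} - {a}. e a / (?p a - ?p b))"
    by (rule sum_off_diagonal_swap)
  also have "(\<Sum>a<?N. \<Sum>b\<in>{..<?N} - {a}. e a / (?p a - ?p b)) = (\<Sum>a<?N. e a * ?S a)"
    by (simp only: sum_distrib_left mult_1_right times_divide_eq_right)
  finally have pairs: "(\<Sum>a<?N. \<Sum>b\<in>{..<?N} - {a}. (e a - e b) / (?p a - ?p b)) =
      2 * (\<Sum>a<?N. e a * ?S a)"
    by (simp only: mult_2)
  have "(\<Sum>a<?N. \<Sum>b\<in>{..<?N} - {a}. 2 * Re ((e a - e b) / (?p a - ?p b))) / 2 =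
      Re (\<Sum>a<?N. \<Sum>b\<in>{..<?N} - {a}. (e a - e b) / (?p a - ?p b))"
    by (simp add: sum_distrib_left[symmetric] del: Re_divide)
  moreover have "e a * energy_force H m n ?p a = e a * (- 2 * ?p a - 2 * h (?p a)) + 2 * (e a * ?S a)" for a
    by (simp add: energy_force_def h_def distrib_left)
  then have "(\<Sum>a<?N. e a * energy_force H m n ?p a) =
      (\<Sum>a<?N. e a * (- 2 * ?p a - 2 * h (?p a))) + 2 * (\<Sum>a<?N. e a * ?S a)"
    by (simp only: sum.distrib sum_distrib_left[symmetric])
  ultimately have "(\<Sum>a<?N. Re (e a * (- 2 * ?p a - 2 * h (?p a))))
      + (\<Sum>a<?N. \<Sum>b\<in>{..<?N} - {a}. 2 * Re ((e a - e b) / (?p a - ?p b))) / 2 =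
      Re (\<Sum>a<?N. e a * energy_force H m n ?p a)"
    by (simp only: pairs plus_complex.sel Re_sum)
  also have "(\<Sum>a<?N. e a * energy_force H m n ?p a) =
      coord_dir m j * energy_force H m n ?p (coord_owner m j)"
    using j by (simp add: e_def if_distrib[of "\<lambda>x. x * _"] cong: if_cong)
  finally show ?thesis
    using DERIV_imp_deriv[OF D] by (simp add: partial_deriv_def u0)
qed

text \<open>The second derivative, in the points \<open>a\<close> and \<open>b\<close>, of the
  holomorphic function whose real part is the energy, that is, the derivative of
  \<open>energy_force\<close> at \<open>a\<close> with respect to \<open>u b\<close>.\<close>

definition hess_symbol :: "complex poly \<Rightarrow> nat \<Rightarrow> nat \<Rightarrow> (nat \<Rightarrow> complex) \<Rightarrow> nat \<Rightarrow> nat \<Rightarrow> complex" where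
  "hess_symbol H m n u a b =
     (if a = b then - 2 - 2 * (poly (pderiv (pderiv H)) (u a) / poly H (u a)
         - (poly (pderiv H) (u a) / poly H (u a))\<^sup>2)
        - 2 * (\<Sum>c\<in>{..<m + n} - {a}. 1 / (u a - u c)\<^sup>2)
      else 2 / (u a - u b)\<^sup>2)"

lemma second_partial_deriv_log_energy:
  assumes ns: "nonsingular_point H m n v"
    and i: "coord_owner m i < m + n" and j: "coord_owner m j < m + n"
  shows "partial_deriv i (partial_deriv j (log_energy H m n)) v =
    Re (coord_dir m i * coord_dir m j *
      hess_symbol H m n (point_coord m v) (coord_owner m i) (coord_owner m j))"
proof -
  let ?N = "m + n" and ?u = "\<lambda>t. point_coord m (v(i := t))" and ?p = "point_coord m v"
  define a where "a = coord_owner m j"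
  define e where "e = (\<lambda>a. if coord_owner m i = a then coord_dir m i else 0)"
  define h where "h = (\<lambda>u. poly (pderiv H) u / poly H u)"
  define h' where "h' = (\<lambda>u. poly (pderiv (pderiv H)) u / poly H u - (h u)\<^sup>2)"
  have "partial_deriv i (partial_deriv j (log_energy H m n)) v =
      deriv (\<lambda>t. Re (coord_dir m j * energy_force H m n (?u t) a)) (v i)"
    unfolding partial_deriv_def[of i] a_def
    using eventually_nonsingular_point[OF ns, of i]
    by (intro deriv_cong_ev refl) (auto elim!: eventually_mono simp: partial_deriv_log_energy j)
  also have "\<dots> = Re (coord_dir m j * (- 2 * e a - 2 * (e a * h' (?p a))
      + 2 * (\<Sum>b\<in>{..<?N} - {a}. (e a - e b) * (- 1 / (?p a - ?p b)\<^sup>2))))"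
  proof (rule DERIV_imp_deriv)
    have u: "((\<lambda>t. ?u t a) has_vector_derivative e a) (at t)" for a t
      unfolding e_def by (rule point_coord_has_vector_derivative)
    have u0: "?u (v i) = ?p" by simp
    have "poly H (?p a) \<noteq> 0"
      using ns j by (simp add: nonsingular_point_def a_def)
    then have "(h has_field_derivative h' (?u (v i) a)) (at (?u (v i) a))"
      unfolding h_def h'_def
      by (auto intro!: derivative_eq_intros simp: u0 power2_eq_square field_simps)
    from field_vector_diff_chain_at[OF u this]
    have dh: "((\<lambda>t. h (?u t a)) has_vector_derivative e a * h' (?p a)) (at (v i))"
      by (simp add: o_def u0 del: fun_upd_apply)
    have dd: "((\<lambda>t. 1 / (?u t a - ?u t b)) has_vector_derivative (e a - e b) * (- 1 / (?p a - ?p b)\<^sup>2)) (at (v i))"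
      if "b \<in> {..<?N} - {a}" for b
    proof -
      have "?p a - ?p b \<noteq> 0"
        using ns that j by (auto simp: nonsingular_point_def a_def dest: inj_onD)
      then have "((\<lambda>u. 1 / u) has_field_derivative - 1 / (?p a - ?p b)\<^sup>2) (at (?p a - ?p b))"
        by (auto intro!: derivative_eq_intros simp: power2_eq_square)
      then have "((\<lambda>u. 1 / u) has_field_derivative - 1 / (?p a - ?p b)\<^sup>2) (at (?u (v i) a - ?u (v i) b))"
        by (simp only: u0)
      from field_vector_diff_chain_at[OF has_vector_derivative_diff[OF u u] this]
      show ?thesis by (simp add: o_def u0 del: fun_upd_apply)
    qed
    show "((\<lambda>t. Re (coord_dir m j * energy_force H m n (?u t) a)) has_real_derivative
      Re (coord_dir m j * (- 2 * e a - 2 * (e a * h' (?p a))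
      + 2 * (\<Sum>b\<in>{..<?N} - {a}. (e a - e b) * (- 1 / (?p a - ?p b)\<^sup>2))))) (at (v i))"
      unfolding energy_force_def h_def[symmetric]
      by (intro has_field_derivative_Re has_vector_derivative_mult_right has_vector_derivative_add
          has_vector_derivative_diff has_vector_derivative_sum u dh dd)
        (simp_all add: u dh[unfolded h_def])
  qed
  also have "- 2 * e a - 2 * (e a * h' (?p a))
      + 2 * (\<Sum>b\<in>{..<?N} - {a}. (e a - e b) * (- 1 / (?p a - ?p b)\<^sup>2)) =
      coord_dir m i * hess_symbol H m n ?p (coord_owner m i) a"
  proof (cases "coord_owner m i = a")
    case True
    then have "(\<Sum>b\<in>{..<?N} - {a}. (e a - e b) * (- 1 / (?p a - ?p b)\<^sup>2)) =
        (\<Sum>b\<in>{..<?N} - {a}. - coord_dir m i * (1 / (?p a - ?p b)\<^sup>2))"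
      by (intro sum.cong) (auto simp: e_def)
    also have "\<dots> = - coord_dir m i * (\<Sum>b\<in>{..<?N} - {a}. 1 / (?p a - ?p b)\<^sup>2)"
      by (simp only: sum_distrib_left)
    finally show ?thesis
      using True by (simp add: hess_symbol_def e_def h'_def h_def algebra_simps)
  next
    case False
    then have "(\<Sum>b\<in>{..<?N} - {a}. (e a - e b) * (- 1 / (?p a - ?p b)\<^sup>2)) =
        (\<Sum>b\<in>{..<?N} - {a}. if b = coord_owner m i then coord_dir m i / (?p a - ?p b)\<^sup>2 else 0)"
      by (intro sum.cong) (auto simp: e_def)
    also have "\<dots> = coord_dir m i / (?p a - ?p (coord_owner m i))\<^sup>2"
      using False i by simp
    finally show ?thesis
      using False by (simp add: hess_symbol_def e_def power2_commute)
  qed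
  finally show ?thesis by (simp add: a_def mult_ac)
qed

subsection \<open>Block Gersgorin sets\<close>

text \<open>The result of Gauss-Jordan elimination is identified by uniqueness of the inverse, so
  explicit inverses can be supplied without running the elimination.\<close>

lemma mat_inverse_eqI:
  assumes "A \<in> carrier_mat k k" "B \<in> carrier_mat k k" "A * B = 1\<^sub>m k" "B * A = 1\<^sub>m k"
  shows "mat_inverse A = Some B"
proof (cases "mat_inverse A")
  case None
  have "A \<in> Units (ring_mat TYPE('a) k ())"
    using assms by (auto simp: Units_def ring_mat_simps)
  with mat_inverse(1)[OF assms(1) None, of "()"] show ?thesis by blast
next
  case (Some B')
  from mat_inverse(2)[OF assms(1) Some] have B': "B' * A = 1\<^sub>m k" "B' \<in> carrier_mat k k" by auto
  have "B' = B' * (A * B)" using assms B' by simp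
  also have "\<dots> = (B' * A) * B" using assms B' by (intro assoc_mult_mat[symmetric]) auto
  also have "\<dots> = B" using assms B' by simp
  finally show ?thesis using Some by simp
qed

section \<open>Conjugation by the scaling matrix\<close>

lemma scaling_mat_mult:
  "scaling_mat m n K * scaling_mat m n L = scaling_mat m n (K * L)"
  by (intro eq_matI) (auto simp: scaling_mat_def scalar_prod_def if_distrib[of "\<lambda>x. x * _"]
      sum.delta cong: if_cong)

lemma mat_inverse_scaling_mat:
  assumes "K \<noteq> 0"
  shows "mat_inverse (scaling_mat m n K) = Some (scaling_mat m n (1 / K))"
proof (rule mat_inverse_eqI)
  have "scaling_mat m n 1 = 1\<^sub>m (2 * m + n)"
    by (intro eq_matI) (auto simp: scaling_mat_def)
  then show "scaling_mat m n K * scaling_mat m n (1 / K) = 1\<^sub>m (2 * m + n)"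
    "scaling_mat m n (1 / K) * scaling_mat m n K = 1\<^sub>m (2 * m + n)"
    using assms by (simp_all add: scaling_mat_mult)
qed (simp_all add: scaling_mat_def)

lemma mat_mult_2_index:
  assumes "A \<in> carrier_mat 2 2" "B \<in> carrier_mat 2 2" "i < 2" "j < 2"
  shows "(A * B) $$ (i, j) = A $$ (i, 0) * B $$ (0, j) + A $$ (i, 1) * B $$ (1, j)"
  using assms by (simp add: scalar_prod_def numeral_2_eq_2)

definition scale_factor :: "nat \<Rightarrow> real \<Rightarrow> nat \<Rightarrow> real" where
  "scale_factor m K a = (if a < m then 1 else K)"

lemma scaled_hessian_index:
  fixes lam :: "nat list" and m :: nat
  assumes "K \<noteq> 0" "m = sum_list lam" "i < 2 * m + n" "j < 2 * m + n"
  shows "scaled_hessian lam n K z x $$ (i, j) =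
    partial_deriv i (partial_deriv j (log_energy (gen_hermite lam) m n)) (zero_point m z x)
      * scale_factor m K (coord_owner m j) / scale_factor m K (coord_owner m i)"
proof -
  let ?N = "2 * m + n"
  let ?Q = "hessian_mat ?N (log_energy (gen_hermite lam) m n) (zero_point m z x)"
  have d: "(if k < 2 * m then 1 else K) = scale_factor m K (coord_owner m k)" for k
    by (auto simp: scale_factor_def coord_owner_def)
  have 1: "(scaling_mat m n L * ?Q) $$ (k, l) = (if k < 2 * m then 1 else L) * ?Q $$ (k, l)"
    if "k < ?N" "l < ?N" for k l L
    using that by (auto simp: scaling_mat_def scalar_prod_def hessian_mat_def
        if_distrib[of "\<lambda>x. x * _"] sum.delta cong: if_cong)
  have 2: "(M * scaling_mat m n K) $$ (k, l) = M $$ (k, l) * (if l < 2 * m then 1 else K)"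
    if "k < ?N" "l < ?N" "M \<in> carrier_mat ?N ?N" for k l M
    using that by (auto simp: scaling_mat_def scalar_prod_def
        if_distrib[of "\<lambda>x. _ * x"] sum.delta' cong: if_cong)
  have "scaled_hessian lam n K z x = scaling_mat m n (1 / K) * ?Q * scaling_mat m n K"
    using assms by (simp add: scaled_hessian_def mat_inverse_scaling_mat Let_def)
  also have "\<dots> $$ (i, j) = (scaling_mat m n (1 / K) * ?Q) $$ (i, j) * (if j < 2 * m then 1 else K)"
    using assms by (intro 2) (auto simp: scaling_mat_def hessian_mat_def)
  also have "\<dots> = (if i < 2 * m then 1 else 1 / K) * ?Q $$ (i, j) * (if j < 2 * m then 1 else K)"
    using assms by (subst 1) auto
  also have "\<dots> = ?Q $$ (i, j) * scale_factor m K (coord_owner m j) / scale_factor m K (coord_owner m i)"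
    unfolding d[symmetric] by auto
  finally show ?thesis using assms by (simp add: hessian_mat_def)
qed

lemma scaled_hessian_carrier:
  "m = sum_list lam \<Longrightarrow> K \<noteq> 0 \<Longrightarrow> scaled_hessian lam n K z x \<in> carrier_mat (2 * m + n) (2 * m + n)"
  by (intro carrier_matI)
    (simp_all add: scaled_hessian_def mat_inverse_scaling_mat Let_def, simp_all add: scaling_mat_def)

section \<open>Blocks and Gersgorin sets of a matrix given by a complex symbol\<close>

definition block_size :: "nat \<Rightarrow> nat \<Rightarrow> nat" where
  "block_size m a = (if a < m then 2 else 1)"

definition block_start :: "nat \<Rightarrow> nat \<Rightarrow> nat" where
  "block_start m a = (if a < m then 2 * a else m + a)"

lemma card_block_idx:
  assumes "a < m + n"
  shows "card {k. k < 2 * m + n \<and> k \<in> block_idx m a} = block_size m a"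
proof -
  have "{k. k < 2 * m + n \<and> k \<in> block_idx m a} = block_idx m a"
    using assms by (auto simp: block_idx_def split: if_splits)
  then show ?thesis by (simp add: block_idx_def block_size_def)
qed

text \<open>Submatrices are addressed through \<open>pick\<close>, the increasing enumeration of an
  index set. Both kinds of blocks are intervals, so it is a shift by
  \<open>block_start m a\<close>.\<close>

lemma pick_block_idx:
  assumes "r < block_size m a"
  shows "pick (block_idx m a) r = block_start m a + r"
proof (cases "a < m")
  case True
  have 0: "pick (block_idx m a) 0 = 2 * a"
    using True by (auto simp: block_idx_def intro!: Least_equality)
  then have "pick (block_idx m a) (Suc 0) = Suc (2 * a)"
    using True by (auto simp: block_idx_def simp del: pick.simps(1) intro!: Least_equality)
  with 0 show ?thesis
    using True assms by (auto simp: block_size_def block_start_def less_Suc_eq numeral_2_eq_2)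
next
  case False
  then have "pick (block_idx m a) 0 = m + a"
    by (auto simp: block_idx_def intro!: Least_equality)
  then show ?thesis
    using False assms by (auto simp: block_size_def block_start_def)
qed

lemma block_index:
  assumes "A \<in> carrier_mat (2 * m + n) (2 * m + n)" "a < m + n" "b < m + n"
  shows "dim_row (block m A a b) = block_size m a" "dim_col (block m A a b) = block_size m b"
    and "r < block_size m a \<Longrightarrow> s < block_size m b \<Longrightarrow>
      block m A a b $$ (r, s) = A $$ (block_start m a + r, block_start m b + s)"
  using assms
  by (auto simp: block_def dim_submatrix card_block_idx submatrix_index pick_block_idx)

lemma block_start_props:
  assumes "a < m + n" "r < block_size m a"
  shows "block_start m a + r < 2 * m + n" "coord_owner m (block_start m a + r) = a"
    "coord_dir m (block_start m a + r) = (if r = 0 then 1 else \<i>)"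
proof -
  consider "a < m" "r = 0" | "a < m" "r = 1" | "\<not> a < m" "r = 0"
    using assms(2) by (auto simp: block_size_def less_2_cases_iff split: if_splits)
  then show "block_start m a + r < 2 * m + n" "coord_owner m (block_start m a + r) = a"
    "coord_dir m (block_start m a + r) = (if r = 0 then 1 else \<i>)"
    using assms(1) by (cases; auto simp: block_start_def coord_owner_def coord_dir_def)+
qed

lemma linf_norm_le:
  assumes "dim_row B > 0" "\<And>r s. r < dim_row B \<Longrightarrow> s < dim_col B \<Longrightarrow> cmod (B $$ (r, s)) \<le> c"
  shows "linf_norm B \<le> of_nat (dim_col B) * c"
  unfolding linf_norm_def
proof (subst Max_le_iff)
  show "\<forall>y\<in>(\<lambda>i. \<Sum>j<dim_col B. cmod (B $$ (i, j))) ` {..<dim_row B}. y \<le> of_nat (dim_col B) * c"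
    using assms(2) by (auto intro!: order_trans[OF sum_bounded_above])
qed (use assms(1) in auto)

text \<open>Isolates what the Gersgorin argument uses about the scaled Hessian: a complex symbol
  indexed by points, the directions of the coordinates and the scaling.\<close>

definition interaction_mat ::
  "nat \<Rightarrow> nat \<Rightarrow> real \<Rightarrow> (nat \<Rightarrow> nat \<Rightarrow> complex) \<Rightarrow> real mat \<Rightarrow> bool" where
  "interaction_mat m n K \<Psi> A \<longleftrightarrow> A \<in> carrier_mat (2 * m + n) (2 * m + n) \<and>
     (\<forall>i<2 * m + n. \<forall>j<2 * m + n. A $$ (i, j) =
        Re (coord_dir m i * coord_dir m j * \<Psi> (coord_owner m i) (coord_owner m j))
        * scale_factor m K (coord_owner m j) / scale_factor m K (coord_owner m i))"

lemma interaction_block: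
  assumes "interaction_mat m n K \<Psi> A" "a < m + n" "b < m + n" "r < block_size m a" "s < block_size m b"
  shows "block m (map_mat complex_of_real A) a b $$ (r, s) = complex_of_real
    (Re ((if r = 0 then 1 else \<i>) * (if s = 0 then 1 else \<i>) * \<Psi> a b)
      * scale_factor m K b / scale_factor m K a)"
proof -
  have A: "A \<in> carrier_mat (2 * m + n) (2 * m + n)" using assms by (simp add: interaction_mat_def)
  then have "block m (map_mat complex_of_real A) a b $$ (r, s) =
      map_mat complex_of_real A $$ (block_start m a + r, block_start m b + s)"
    using assms by (intro block_index) auto
  also have "\<dots> = complex_of_real (A $$ (block_start m a + r, block_start m b + s))"
    using A block_start_props(1)[OF assms(2,4)] block_start_props(1)[OF assms(3,5)] by simp
  finally show ?thesis
    using assms(1) block_start_props[OF assms(2,4)] block_start_props[OF assms(3,5)]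
    by (simp add: interaction_mat_def)
qed

text \<open>Before scaling, an entry is the real part of \<open>\<Psi> a b\<close> times 1,
  \<open>\<i>\<close> or -1, hence at most its modulus, and a row of the block has
  \<open>block_size m b\<close> entries.\<close>

lemma interaction_block_norm:
  assumes A: "interaction_mat m n K \<Psi> A" and ab: "a < m + n" "b < m + n" and K: "K > 0"
  shows "linf_norm (block m (map_mat complex_of_real A) a b) \<le>
    block_size m b * (cmod (\<Psi> a b) * scale_factor m K b / scale_factor m K a)"
proof -
  let ?B = "block m (map_mat complex_of_real A) a b"
  have c: "map_mat complex_of_real A \<in> carrier_mat (2 * m + n) (2 * m + n)"
    using A by (simp add: interaction_mat_def)
  note dims = block_index(1,2)[OF c ab]
  have sf: "scale_factor m K c > 0" for c using K by (simp add: scale_factor_def)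
  have "linf_norm ?B \<le> of_nat (dim_col ?B) * (cmod (\<Psi> a b) * scale_factor m K b / scale_factor m K a)"
  proof (rule linf_norm_le)
    show "dim_row ?B > 0" by (simp add: dims block_size_def)
    fix r s assume "r < dim_row ?B" "s < dim_col ?B"
    then have "cmod (?B $$ (r, s)) =
       \<bar>Re ((if r = 0 then 1 else \<i>) * (if s = 0 then 1 else \<i>) * \<Psi> a b)\<bar>
         * scale_factor m K b / scale_factor m K a"
      using sf[of a] sf[of b] by (simp add: interaction_block[OF A ab] dims abs_mult norm_mult norm_divide)
    also have "\<dots> \<le> cmod (\<Psi> a b) * scale_factor m K b / scale_factor m K a"
      using sf[of a] sf[of b]
      by (intro divide_right_mono mult_right_mono)
        (auto simp: abs_Re_le_cmod abs_Im_le_cmod)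
    finally show "cmod (?B $$ (r, s)) \<le> cmod (\<Psi> a b) * scale_factor m K b / scale_factor m K a" .
  qed
  then show ?thesis by (simp add: dims)
qed

text \<open>An upper bound for the sum of block norms. A larger radius only enlarges the set, so
  bounds proved with it hold on the Gersgorin set itself.\<close>

definition block_radius :: "nat \<Rightarrow> nat \<Rightarrow> real \<Rightarrow> (nat \<Rightarrow> nat \<Rightarrow> complex) \<Rightarrow> nat \<Rightarrow> real" where
  "block_radius m n K \<Psi> a = (\<Sum>b\<in>{..<m + n} - {a}.
     block_size m b * (cmod (\<Psi> a b) * scale_factor m K b / scale_factor m K a))"

lemma gersgorin_interaction:
  assumes A: "interaction_mat m n K \<Psi> A" and a: "a < m + n" and K: "K > 0"
    and t: "u \<in> gersgorin m n (map_mat complex_of_real A) a"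
  shows "inv_norm_inv (u \<cdot>\<^sub>m 1\<^sub>m (block_size m a) - block m (map_mat complex_of_real A) a a)
    \<le> block_radius m n K \<Psi> a"
proof -
  have c: "map_mat complex_of_real A \<in> carrier_mat (2 * m + n) (2 * m + n)"
    using A by (simp add: interaction_mat_def)
  have "inv_norm_inv (u \<cdot>\<^sub>m 1\<^sub>m (block_size m a) - block m (map_mat complex_of_real A) a a) \<le>
      (\<Sum>b\<in>{..<m + n} - {a}. linf_norm (block m (map_mat complex_of_real A) a b))"
    using t by (simp add: gersgorin_def block_index(1)[OF c a a])
  also have "\<dots> \<le> block_radius m n K \<Psi> a"
    unfolding block_radius_def by (intro sum_mono interaction_block_norm[OF A a _ K]) auto
  finally show ?thesis .
qed

lemma gersgorin_singleton:
  assumes A: "interaction_mat m n K \<Psi> A" and a: "m \<le> a" "a < m + n" and K: "K > 0"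
    and t: "complex_of_real t \<in> gersgorin m n (map_mat complex_of_real A) a"
  shows "\<bar>t - Re (\<Psi> a a)\<bar> \<le> block_radius m n K \<Psi> a"
proof (cases "t = Re (\<Psi> a a)")
  \<comment> \<open>At the centre the matrix is singular and there is no inverse to estimate; the
    claim reduces to nonnegativity of the radius.\<close>
  case True
  have "block_radius m n K \<Psi> a \<ge> 0"
    unfolding block_radius_def using K
    by (intro sum_nonneg mult_nonneg_nonneg divide_nonneg_nonneg) (auto simp: scale_factor_def)
  with True show ?thesis by simp
next
  case False
  let ?c = "complex_of_real (t - Re (\<Psi> a a))"
  let ?M = "complex_of_real t \<cdot>\<^sub>m 1\<^sub>m (block_size m a) - block m (map_mat complex_of_real A) a a"
  let ?B = "mat 1 1 (\<lambda>_. 1 / ?c)"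
  have c: "map_mat complex_of_real A \<in> carrier_mat (2 * m + n) (2 * m + n)"
    using A by (simp add: interaction_mat_def)
  have bs: "block_size m a = 1" using a by (simp add: block_size_def)
  have "block m (map_mat complex_of_real A) a a $$ (0, 0) = complex_of_real (Re (\<Psi> a a))"
    using interaction_block[OF A a(2) a(2), of 0 0] bs K by (simp add: scale_factor_def)
  then have M: "?M = mat 1 1 (\<lambda>_. ?c)"
    by (intro eq_matI) (auto simp: bs block_index(1,2)[OF c a(2) a(2)])
  have "mat_inverse ?M = Some ?B"
    unfolding M
    by (rule mat_inverse_eqI[where k = 1])
      (use False in \<open>auto intro!: eq_matI simp: scalar_prod_def simp flip: of_real_diff\<close>)
  moreover have "linf_norm ?B = 1 / \<bar>t - Re (\<Psi> a a)\<bar>"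
    by (simp add: linf_norm_def norm_divide lessThan_Suc flip: of_real_diff)
  ultimately have "inv_norm_inv ?M = \<bar>t - Re (\<Psi> a a)\<bar>"
    by (simp add: inv_norm_inv_def)
  then show ?thesis using gersgorin_interaction[OF A a(2) K t] by simp
qed

text \<open>With \<open>\<alpha>\<close> and \<open>\<beta>\<close> the real and imaginary parts of
  \<open>\<Psi> a a\<close>, the block has rows \<open>(\<alpha>, -\<beta>)\<close> and
  \<open>(-\<beta>, -\<alpha>)\<close>. So \<open>t\<close> minus the block has determinant
  \<open>D\<close>, the difference on the left, and its adjugate has row sums at most
  \<open>\<bar>t\<bar> + 2 * cmod (\<Psi> a a)\<close>.\<close>

lemma gersgorin_pair:
  assumes A: "interaction_mat m n K \<Psi> A" and a: "a < m" and K: "K > 0"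
    and t: "complex_of_real t \<in> gersgorin m n (map_mat complex_of_real A) a"
  shows "\<bar>t\<^sup>2 - (cmod (\<Psi> a a))\<^sup>2\<bar> \<le> block_radius m n K \<Psi> a * (\<bar>t\<bar> + 2 * cmod (\<Psi> a a))"
proof (cases "t\<^sup>2 = (cmod (\<Psi> a a))\<^sup>2")
  case True
  have "block_radius m n K \<Psi> a \<ge> 0"
    unfolding block_radius_def using K
    by (intro sum_nonneg mult_nonneg_nonneg divide_nonneg_nonneg) (auto simp: scale_factor_def)
  with True show ?thesis by simp
next
  case False
  have a': "a < m + n" using a by simp
  define \<alpha> \<beta> D where "\<alpha> = Re (\<Psi> a a)" and "\<beta> = Im (\<Psi> a a)" and "D = t\<^sup>2 - (cmod (\<Psi> a a))\<^sup>2"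
  have D: "D \<noteq> 0" "D = t\<^sup>2 - \<alpha>\<^sup>2 - \<beta>\<^sup>2"
    using False by (auto simp: D_def \<alpha>_def \<beta>_def cmod_power2)
  let ?M = "complex_of_real t \<cdot>\<^sub>m 1\<^sub>m (block_size m a) - block m (map_mat complex_of_real A) a a"
  define M where "M = mat 2 2 (\<lambda>(i, j). if i = j then if i = 0 then t - \<alpha> else t + \<alpha> else \<beta>)"
  define B where "B = mat 2 2 (\<lambda>(i, j). (if i = j then if i = 0 then t + \<alpha> else t - \<alpha> else - \<beta>) / D)"
  have c: "map_mat complex_of_real A \<in> carrier_mat (2 * m + n) (2 * m + n)"
    using A by (simp add: interaction_mat_def)
  have bs: "block_size m a = 2" using a by (simp add: block_size_def)
  have blk: "block m (map_mat complex_of_real A) a a $$ (r, s) =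
      complex_of_real (Re ((if r = 0 then 1 else \<i>) * (if s = 0 then 1 else \<i>) * \<Psi> a a))"
    if "r < 2" "s < 2" for r s
    using interaction_block[OF A a' a', of r s] that bs a K by (simp add: scale_factor_def)
  have M: "?M = map_mat complex_of_real M"
    by (intro eq_matI)
      (auto simp: bs block_index(1,2)[OF c a' a'] blk M_def \<alpha>_def \<beta>_def less_Suc_eq numeral_2_eq_2)
  have carr: "M \<in> carrier_mat 2 2" "B \<in> carrier_mat 2 2" by (auto simp: M_def B_def)
  have prods: "(t - \<alpha>) * (t + \<alpha>) + \<beta> * - \<beta> = D" "(t + \<alpha>) * (t - \<alpha>) + - \<beta> * \<beta> = D"
    by (simp_all add: D(2) algebra_simps power2_eq_square)
  have MB: "M * B = 1\<^sub>m 2"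
  proof (rule eq_matI)
    fix i j :: nat assume "i < dim_row (1\<^sub>m 2 :: real mat)" "j < dim_col (1\<^sub>m 2 :: real mat)"
    then have ij: "i < 2" "j < 2" by simp_all
    have "(t - \<alpha>) * ((t + \<alpha>) / D) + \<beta> * (- \<beta> / D) = 1" "\<beta> * (- \<beta> / D) + (t + \<alpha>) * ((t - \<alpha>) / D) = 1"
      "(t - \<alpha>) * (- \<beta> / D) + \<beta> * ((t - \<alpha>) / D) = 0" "\<beta> * ((t + \<alpha>) / D) + (t + \<alpha>) * (- \<beta> / D) = 0"
      using prods D(1) by (simp_all add: add_divide_distrib[symmetric] diff_divide_distrib[symmetric])
    with ij show "(M * B) $$ (i, j) = 1\<^sub>m 2 $$ (i, j)"
      unfolding mat_mult_2_index[OF carr ij]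
      by (auto simp: M_def B_def less_2_cases_iff)
  qed (use carr in simp_all)
  have BM: "B * M = 1\<^sub>m 2"
    using mat_mult_left_right_inverse[OF carr MB] .
  have hom: "map_mat complex_of_real X * map_mat complex_of_real Y = map_mat complex_of_real (X * Y)"
    if "X \<in> carrier_mat 2 2" "Y \<in> carrier_mat 2 2" for X Y
    by (rule of_real_hom.mat_hom_mult[OF that, symmetric])
  have one: "map_mat complex_of_real (1\<^sub>m 2) = 1\<^sub>m 2"
    by (intro eq_matI) auto
  have "mat_inverse ?M = Some (map_mat complex_of_real B)"
    unfolding M
    by (rule mat_inverse_eqI[where k = 2]) (use carr in \<open>simp_all add: hom MB BM one\<close>)
  then have inv: "inv_norm_inv ?M = inverse (linf_norm (map_mat complex_of_real B))"
    by (simp add: inv_norm_inv_def)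
  have le: "\<bar>\<alpha>\<bar> \<le> cmod (\<Psi> a a)" "\<bar>\<beta>\<bar> \<le> cmod (\<Psi> a a)"
    by (simp_all add: \<alpha>_def \<beta>_def abs_Re_le_cmod abs_Im_le_cmod)
  have norm: "linf_norm (map_mat complex_of_real B) =
      max (\<bar>t + \<alpha>\<bar> / \<bar>D\<bar> + \<bar>\<beta>\<bar> / \<bar>D\<bar>) (\<bar>\<beta>\<bar> / \<bar>D\<bar> + \<bar>t - \<alpha>\<bar> / \<bar>D\<bar>)"
  proof -
    have "{..<dim_row (map_mat complex_of_real B)} = {0, 1}" by (auto simp: B_def)
    then show ?thesis
      by (simp add: linf_norm_def B_def numeral_2_eq_2 norm_divide flip: of_real_add of_real_diff)
  qed
  have "linf_norm (map_mat complex_of_real B) \<le> (\<bar>t\<bar> + 2 * cmod (\<Psi> a a)) / \<bar>D\<bar>"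
    unfolding norm add_divide_distrib[symmetric]
    by (intro max.boundedI divide_right_mono) (use le in \<open>linarith, simp, linarith, simp\<close>)
  \<comment> \<open>Passing to reciprocals requires a positive norm: a vanishing first row of
    \<open>B\<close> would force \<open>D = 0\<close>.\<close>
  moreover have "\<bar>t + \<alpha>\<bar> + \<bar>\<beta>\<bar> > 0"
  proof (rule ccontr)
    assume "\<not> ?thesis"
    then have "t = - \<alpha>" "\<beta> = 0" by linarith+
    with D show False by simp
  qed
  then have "linf_norm (map_mat complex_of_real B) > 0"
    unfolding norm add_divide_distrib[symmetric] less_max_iff_disj using D(1) zero_less_divide_iff by fastforce
  ultimately have "inverse ((\<bar>t\<bar> + 2 * cmod (\<Psi> a a)) / \<bar>D\<bar>) \<le> inv_norm_inv ?M"
    unfolding inv by (intro le_imp_inverse_le)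
  also have "\<dots> \<le> block_radius m n K \<Psi> a"
    by (rule gersgorin_interaction[OF A a' K t])
  finally have "\<bar>D\<bar> / (\<bar>t\<bar> + 2 * cmod (\<Psi> a a)) \<le> block_radius m n K \<Psi> a"
    by simp
  moreover have "\<bar>t\<bar> + 2 * cmod (\<Psi> a a) > 0"
  proof (rule ccontr)
    assume "\<not> ?thesis"
    then have "t = 0" "cmod (\<Psi> a a) = 0"
      using norm_ge_zero[of "\<Psi> a a"] by linarith+
    with False show False by simp
  qed
  ultimately show ?thesis by (simp add: divide_le_eq D_def)
qed

subsection \<open>Estimates at the zeros\<close>

definition all_zeros :: "nat \<Rightarrow> (nat \<Rightarrow> complex) \<Rightarrow> (nat \<Rightarrow> real) \<Rightarrow> nat \<Rightarrow> complex" where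
  "all_zeros m z x a = (if a < m then z a else complex_of_real (x (a - m)))"

lemma point_coord_zero_point: "point_coord m (zero_point m z x) = all_zeros m z x"
  by (auto simp: fun_eq_iff point_coord_def zero_point_def all_zeros_def exc_coord_def reg_coord_def
      complex_eq_iff)

text \<open>The part of the labelling that concerns a single \<open>n\<close>. Identities and
  estimates are proved at fixed \<open>n\<close>; limits enter only when the thresholds on
  \<open>n\<close> are chosen.\<close>

definition zero_config ::
  "nat list \<Rightarrow> nat \<Rightarrow> (nat \<Rightarrow> complex) \<Rightarrow> (nat \<Rightarrow> complex) \<Rightarrow> (nat \<Rightarrow> real) \<Rightarrow> bool" where
  "zero_config lam n w z x \<longleftrightarrow>
     bij_betw w {..<sum_list lam} {u. poly (gen_hermite lam) u = 0} \<and>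
     bij_betw z {..<sum_list lam} {u. poly (exc_hermite lam n) u = 0 \<and> Im u \<noteq> 0} \<and>
     bij_betw x {..<n} {t. poly (exc_hermite lam n) (complex_of_real t) = 0}"

text \<open>A finite zero set rules out the zero polynomial, and \<open>m\<close> distinct zeros
  exhaust the degree bound \<open>m\<close>.\<close>

lemma gen_hermite_factorization:
  assumes "bij_betw w {..<sum_list lam} {u. poly (gen_hermite lam) u = 0}"
  shows "\<exists>c. c \<noteq> 0 \<and> gen_hermite lam = smult c (\<Prod>k<sum_list lam. [:- w k, 1:])"
proof (rule poly_eq_prod_roots)
  have "finite {u. poly (gen_hermite lam) u = 0}"
    using bij_betw_finite[OF assms] by simp
  then show "gen_hermite lam \<noteq> 0"
    using infinite_UNIV_char_0[where 'a = complex] by auto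
  show "degree (gen_hermite lam) \<le> card {..<sum_list lam}"
    by (simp add: degree_gen_hermite)
qed (use assms in \<open>auto simp: bij_betw_def\<close>)

lemma all_zeros_inj:
  assumes "zero_config lam n w z x"
  shows "inj_on (all_zeros (sum_list lam) z x) {..<sum_list lam + n}"
proof (rule inj_onI)
  let ?m = "sum_list lam"
  fix a b assume ab: "a \<in> {..<?m + n}" "b \<in> {..<?m + n}" "all_zeros ?m z x a = all_zeros ?m z x b"
  have z: "Im (z k) \<noteq> 0" if "k < ?m" for k
    using assms that by (auto simp: zero_config_def bij_betw_def)
  show "a = b"
  proof (cases "a < ?m"; cases "b < ?m")
    assume "a < ?m" "b < ?m"
    then show ?thesis using ab assms
      by (auto simp: all_zeros_def zero_config_def bij_betw_def dest: inj_onD)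
  next
    assume "a < ?m" "\<not> b < ?m"
    then show ?thesis using ab z[of a] by (simp add: all_zeros_def)
  next
    assume "\<not> a < ?m" "b < ?m"
    then show ?thesis using ab z[of b] by (auto simp: all_zeros_def dest: sym)
  next
    assume *: "\<not> a < ?m" "\<not> b < ?m"
    then have "x (a - ?m) = x (b - ?m)" "a - ?m < n" "b - ?m < n"
      using ab by (auto simp: all_zeros_def)
    then have "a - ?m = b - ?m"
      using assms by (auto simp: zero_config_def bij_betw_def dest: inj_onD)
    with * show ?thesis by simp
  qed
qed

lemma exc_hermite_factorization:
  assumes "zero_config lam n w z x"
  shows "\<exists>d. d \<noteq> 0 \<and> exc_hermite lam n =
    smult d (\<Prod>a<sum_list lam + n. [:- all_zeros (sum_list lam) z x a, 1:])"
proof (rule poly_eq_prod_roots)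
  have "finite {u. poly (exc_hermite lam n) u = 0 \<and> Im u \<noteq> 0}"
    using assms bij_betw_finite by (fastforce simp: zero_config_def)
  \<comment> \<open>The zero polynomial would have all of these as its non-real zeros.\<close>
  moreover have "infinite {u. Im u \<noteq> 0}"
  proof
    assume "finite {u. Im u \<noteq> 0}"
    then have "finite (range (\<lambda>k::nat. Complex (of_nat k) 1))"
      by (rule rev_finite_subset) auto
    moreover have "inj (\<lambda>k::nat. Complex (of_nat k) 1)" by (auto simp: inj_on_def)
    ultimately show False using finite_imageD by blast
  qed
  ultimately show "exc_hermite lam n \<noteq> 0" by auto
  show "inj_on (all_zeros (sum_list lam) z x) {..<sum_list lam + n}"
    by (rule all_zeros_inj[OF assms])
  show "degree (exc_hermite lam n) \<le> card {..<sum_list lam + n}"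
    by (simp add: degree_exc_hermite)
  fix a assume "a \<in> {..<sum_list lam + n}"
  then show "poly (exc_hermite lam n) (all_zeros (sum_list lam) z x a) = 0"
    using assms by (auto simp: zero_config_def bij_betw_def all_zeros_def)
qed simp

text \<open>Both polynomials are products of distinct linear factors, so a common zero would be
  simple for both, which the differential equation forbids. In the last formula the derivative of
  \<open>H' / H\<close> is written as minus the sum of \<open>1 / (u a - w k)^2\<close>.\<close>

lemma zero_config_relations:
  fixes lam :: "nat list" and m n a :: nat
  assumes ev: "even (length lam)" and m: "m = sum_list lam"
    and conf: "zero_config lam n w z x" and a: "a < m + n"
  defines "u \<equiv> all_zeros m z x"
  shows "poly (gen_hermite lam) (u a) \<noteq> 0"
    and "\<And>k. k < m \<Longrightarrow> u a \<noteq> w k"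
    and "(\<Sum>b\<in>{..<m + n} - {a}. 1 / (u a - u b)) = u a + (\<Sum>k<m. 1 / (u a - w k))"
    and "3 * (\<Sum>b\<in>{..<m + n} - {a}. 1 / (u a - u b)\<^sup>2) =
      2 * of_nat n - 2 + (\<Sum>k<m. 1 / (u a - w k)\<^sup>2) - (u a)\<^sup>2"
    and "hess_symbol (gen_hermite lam) m n u a a =
      - 2 + 2 * (\<Sum>k<m. 1 / (u a - w k)\<^sup>2) - 2 * (\<Sum>b\<in>{..<m + n} - {a}. 1 / (u a - u b)\<^sup>2)"
proof -
  have wb: "bij_betw w {..<sum_list lam} {u. poly (gen_hermite lam) u = 0}"
    using conf by (simp add: zero_config_def)
  obtain c where H: "c \<noteq> 0" "gen_hermite lam = smult c (\<Prod>k<m. [:- w k, 1:])"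
    using gen_hermite_factorization[OF wb] m by auto
  obtain d where P: "d \<noteq> 0" "exc_hermite lam n = smult d (\<Prod>a<m + n. [:- u a, 1:])"
    using exc_hermite_factorization[OF conf] m u_def by auto
  have inj: "inj_on u {..<m + n}" using all_zeros_inj[OF conf] m u_def by simp
  have winj: "inj_on w {..<m}" using wb m by (simp add: bij_betw_def)
  note ode = exc_hermite_ode[OF ev, of n]
  have P0: "poly (exc_hermite lam n) (u a) = 0"
    using a by (auto simp: P(2) poly_prod)
  have P1: "poly (pderiv (exc_hermite lam n)) (u a) \<noteq> 0"
    using pderiv_nonzero_simple_root[OF P(2,1) _ inj] a by simp
  show ne: "poly (gen_hermite lam) (u a) \<noteq> 0"
  proof
    assume 0: "poly (gen_hermite lam) (u a) = 0"
    then obtain k where k: "k < m" "u a = w k"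
      using wb m by (auto simp: bij_betw_def)
    then have "poly (pderiv (gen_hermite lam)) (u a) \<noteq> 0"
      using pderiv_nonzero_simple_root[OF H(2,1) _ winj, of k] by simp
    with no_common_simple_zero[OF ode P0 P1] 0 show False by simp
  qed
  show new: "u a \<noteq> w k" if "k < m" for k
    using ne that by (auto simp: H(2) poly_prod)
  show "(\<Sum>b\<in>{..<m + n} - {a}. 1 / (u a - u b)) = u a + (\<Sum>k<m. 1 / (u a - w k))"
    "3 * (\<Sum>b\<in>{..<m + n} - {a}. 1 / (u a - u b)\<^sup>2) =
      2 * of_nat n - 2 + (\<Sum>k<m. 1 / (u a - w k)\<^sup>2) - (u a)\<^sup>2"
    using stieltjes_relations[OF ode H(2,1) _ P(2,1) _ inj _ ne] a by simp_all
  let ?h = "\<Sum>k<m. 1 / (u a - w k)" and ?T = "\<Sum>k<m. 1 / (u a - w k)\<^sup>2"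
  have "poly (pderiv (gen_hermite lam)) (u a) = poly (gen_hermite lam) (u a) * ?h"
    "poly (pderiv (pderiv (gen_hermite lam))) (u a) = poly (gen_hermite lam) (u a) * (?h\<^sup>2 - ?T)"
    using poly_derivs_prod_roots[of "{..<m}" "u a" w] new
    by (simp_all add: H(2) pderiv_smult)
  then show "hess_symbol (gen_hermite lam) m n u a a =
      - 2 + 2 * ?T - 2 * (\<Sum>b\<in>{..<m + n} - {a}. 1 / (u a - u b)\<^sup>2)"
    using ne by (simp add: hess_symbol_def)
qed

lemma interaction_scaled_hessian:
  fixes lam :: "nat list" and m n :: nat
  assumes ev: "even (length lam)" and m: "m = sum_list lam"
    and conf: "zero_config lam n w z x" and K: "K > 0"
  shows "interaction_mat m n K (hess_symbol (gen_hermite lam) m n (all_zeros m z x))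
    (scaled_hessian lam n K z x)"
proof -
  have ns: "nonsingular_point (gen_hermite lam) m n (zero_point m z x)"
    unfolding nonsingular_point_def point_coord_zero_point
    using zero_config_relations(1)[OF ev m conf] all_zeros_inj[OF conf] m by simp
  have own: "coord_owner m i < m + n" if "i < 2 * m + n" for i
    using that by (auto simp: coord_owner_def)
  show ?thesis
    unfolding interaction_mat_def
    using K scaled_hessian_carrier[OF m, of K] own
    by (auto simp: scaled_hessian_index[OF _ m] second_partial_deriv_log_energy[OF ns]
        point_coord_zero_point)
qed

section \<open>Estimates at the regular zeros\<close>

lemma sum_remove_low:
  fixes f :: "nat \<Rightarrow> 'a::ab_group_add"
  assumes "k < m"
  shows "(\<Sum>b\<in>{..<m + n} - {k}. f b) = (\<Sum>l\<in>{..<m} - {k}. f l) + (\<Sum>i<n. f (m + i))"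
  using assms by (simp add: sum_diff1 sum_add_lessThan)

lemma sum_remove_high:
  fixes f :: "nat \<Rightarrow> 'a::ab_group_add"
  assumes "i < n"
  shows "(\<Sum>b\<in>{..<m + n} - {m + i}. f b) = (\<Sum>k<m. f k) + (\<Sum>j\<in>{..<n} - {i}. f (m + j))"
  using assms by (simp add: sum_diff1 sum_add_lessThan)

lemma abs_Im_le_dist_real: "\<bar>Im u\<bar> \<le> cmod (complex_of_real t - u)"
  using abs_Im_le_cmod[of "complex_of_real t - u"] by simp

lemma inverse_square_diff_bound:
  fixes p q :: complex
  assumes "\<beta> > 0" "\<beta> \<le> cmod p" "\<beta> \<le> cmod q"
  shows "cmod (1 / p\<^sup>2 - 1 / q\<^sup>2) \<le> 2 * cmod (p - q) / \<beta> ^ 3"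
proof -
  have ne: "p \<noteq> 0" "q \<noteq> 0" using assms by auto
  have "1 / p\<^sup>2 - 1 / q\<^sup>2 = (q - p) * (1 / (p * q\<^sup>2) + 1 / (p\<^sup>2 * q))"
    using ne by (simp add: field_simps power2_eq_square)
  then have "cmod (1 / p\<^sup>2 - 1 / q\<^sup>2) = cmod (p - q) * cmod (1 / (p * q\<^sup>2) + 1 / (p\<^sup>2 * q))"
    by (simp add: norm_mult norm_minus_commute)
  also have "\<dots> \<le> cmod (p - q) * (1 / \<beta> ^ 3 + 1 / \<beta> ^ 3)"
  proof (intro mult_left_mono order_trans[OF norm_triangle_ineq] add_mono)
    have "\<beta> ^ 3 \<le> cmod p * (cmod q)\<^sup>2" "\<beta> ^ 3 \<le> (cmod p)\<^sup>2 * cmod q"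
      using assms by (auto simp: power3_eq_cube power2_eq_square mult.assoc intro!: mult_mono)
    then show "cmod (1 / (p * q\<^sup>2)) \<le> 1 / \<beta> ^ 3" "cmod (1 / (p\<^sup>2 * q)) \<le> 1 / \<beta> ^ 3"
      using assms ne by (auto simp: norm_divide norm_mult norm_power intro!: divide_left_mono mult_pos_pos)
  qed simp
  finally show ?thesis by (simp add: mult.commute)
qed

text \<open>With \<open>Q\<close> the sum over the other regular zeros, the centre is
  \<open>- 2 + 2 * Re (T - Z) - 2 * Q\<close> and the radius at most \<open>1 + 2 * Q\<close>. As
  \<open>Re (T - Z)\<close> is at most 1/8, the right end is at most \<open>- 3 / 4\<close>. For the
  left end, the second Stieltjes relation bounds \<open>4 * Q\<close> by \<open>8 * n / 3\<close>
  plus a constant, which leaves room below \<open>4 * n\<close>.\<close>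

lemma regular_gersgorin_bound:
  fixes lam :: "nat list" and m n i :: nat
  assumes ev: "even (length lam)" and m: "m = sum_list lam"
    and conf: "zero_config lam n w z x" and i: "i < n"
    and \<beta>: "\<beta> > 0" "\<And>k. k < m \<Longrightarrow> \<beta> \<le> \<bar>Im (w k)\<bar>" "\<And>k. k < m \<Longrightarrow> \<beta> \<le> \<bar>Im (z k)\<bar>"
    and close: "(\<Sum>k<m. cmod (z k - w k)) \<le> \<beta> ^ 3 / 16"
    and K: "K > 0" "4 * real m \<le> \<beta>\<^sup>2 * K"
    and large: "4 + 6 * real m / \<beta>\<^sup>2 \<le> real n"
    and t: "\<bar>t - Re (hess_symbol (gen_hermite lam) m n (all_zeros m z x) (m + i) (m + i))\<bar>
      \<le> block_radius m n K (hess_symbol (gen_hermite lam) m n (all_zeros m z x)) (m + i)"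
  shows "t < 0 \<and> \<bar>t\<bar> \<le> 4 * real n"
proof -
  let ?u = "all_zeros m z x" and ?y = "complex_of_real (x i)"
  let ?\<Psi> = "hess_symbol (gen_hermite lam) m n ?u"
  define T where "T = (\<Sum>k<m. 1 / (?y - w k)\<^sup>2)"
  define Z where "Z = (\<Sum>k<m. 1 / (?y - z k)\<^sup>2)"
  define Q where "Q = (\<Sum>j\<in>{..<n} - {i}. 1 / (x i - x j)\<^sup>2)"
  have a: "m + i < m + n" using i by simp
  have ua: "?u (m + i) = ?y" by (simp add: all_zeros_def)
  have "(\<Sum>b\<in>{..<m + n} - {m + i}. 1 / (?y - ?u b)\<^sup>2) =
      Z + (\<Sum>j\<in>{..<n} - {i}. 1 / (?y - complex_of_real (x j))\<^sup>2)"
    by (simp add: sum_remove_high[OF i] all_zeros_def Z_def)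
  also have "(\<Sum>j\<in>{..<n} - {i}. 1 / (?y - complex_of_real (x j))\<^sup>2) = complex_of_real Q"
    by (simp add: Q_def)
  finally have S2: "(\<Sum>b\<in>{..<m + n} - {m + i}. 1 / (?y - ?u b)\<^sup>2) = Z + complex_of_real Q" .
  note rel = zero_config_relations[OF ev m conf a, unfolded ua S2, folded T_def]
  have \<Psi>: "Re (?\<Psi> (m + i) (m + i)) = - 2 + 2 * Re T - 2 * (Re Z + Q)"
    unfolding rel(5) by simp
  have eq: "3 * (Re Z + Q) = 2 * real n - 2 + Re T - (x i)\<^sup>2"
    using arg_cong[OF rel(4), of Re] by (simp flip: of_real_power)
  have yw: "\<beta> \<le> cmod (?y - w k)" "\<beta> \<le> cmod (?y - z k)" if "k < m" for k
    using order_trans[OF \<beta>(2) abs_Im_le_dist_real] order_trans[OF \<beta>(3) abs_Im_le_dist_real] that by auto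
  have inv2: "cmod (1 / p\<^sup>2) \<le> 1 / \<beta>\<^sup>2" if "\<beta> \<le> cmod p" for p
    using frac_le[of 1 1 "\<beta>\<^sup>2" "(cmod p)\<^sup>2"] that \<beta>(1) by (simp add: norm_divide norm_power power_mono)
  have bT: "cmod T \<le> real m / \<beta>\<^sup>2"
    unfolding T_def using sum_norm_bound[of "{..<m}" "\<lambda>k. 1 / (?y - w k)\<^sup>2" "1 / \<beta>\<^sup>2"] inv2 yw by simp
  have bZ: "cmod Z \<le> real m / \<beta>\<^sup>2"
    unfolding Z_def using sum_norm_bound[of "{..<m}" "\<lambda>k. 1 / (?y - z k)\<^sup>2" "1 / \<beta>\<^sup>2"] inv2 yw by simp
  have "cmod (T - Z) \<le> (\<Sum>k<m. cmod (1 / (?y - w k)\<^sup>2 - 1 / (?y - z k)\<^sup>2))"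
    unfolding T_def Z_def sum_subtractf[symmetric] by (rule norm_sum)
  also have "\<dots> \<le> (\<Sum>k<m. 2 * cmod (z k - w k) / \<beta> ^ 3)"
  proof (intro sum_mono)
    fix k assume "k \<in> {..<m}"
    with inverse_square_diff_bound[OF \<beta>(1) yw, of k k]
    show "cmod (1 / (?y - w k)\<^sup>2 - 1 / (?y - z k)\<^sup>2) \<le> 2 * cmod (z k - w k) / \<beta> ^ 3" by simp
  qed
  also have "\<dots> = 2 * (\<Sum>k<m. cmod (z k - w k)) / \<beta> ^ 3"
    by (simp add: sum_distrib_left sum_divide_distrib)
  also have "\<dots> \<le> 1 / 8" using close \<beta>(1) by (simp add: divide_le_eq)
  finally have TZ: "\<bar>Re T - Re Z\<bar> \<le> 1 / 8"
    using abs_Re_le_cmod[of "T - Z"] by simp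
  have "Q \<ge> 0" unfolding Q_def by (intro sum_nonneg) simp
  have "block_radius m n K ?\<Psi> (m + i) = (\<Sum>k<m. 2 * (cmod (2 / (?y - z k)\<^sup>2) / K))
      + (\<Sum>j\<in>{..<n} - {i}. cmod (2 / (?y - complex_of_real (x j))\<^sup>2))"
    unfolding block_radius_def sum_remove_high[OF i] using K(1)
    by (simp add: block_size_def scale_factor_def hess_symbol_def all_zeros_def)
  also have "(\<Sum>j\<in>{..<n} - {i}. cmod (2 / (?y - complex_of_real (x j))\<^sup>2)) = 2 * Q"
    by (simp add: Q_def sum_distrib_left norm_divide norm_power flip: of_real_diff)
  \<comment> \<open>One factor 2 counts the two columns of a pair block, the other comes from the
    symbol. This is where \<open>K\<close> keeps the contribution of the exceptional zeros at most
    1.\<close>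
  also have "(\<Sum>k<m. 2 * (cmod (2 / (?y - z k)\<^sup>2) / K)) \<le> (\<Sum>k<m. 4 / (\<beta>\<^sup>2 * K))"
  proof (intro sum_mono)
    fix k assume "k \<in> {..<m}"
    then have "4 * cmod (1 / (?y - z k)\<^sup>2) / K \<le> 4 * (1 / \<beta>\<^sup>2) / K"
      using K(1) by (intro divide_right_mono mult_left_mono inv2 yw) auto
    then show "2 * (cmod (2 / (?y - z k)\<^sup>2) / K) \<le> 4 / (\<beta>\<^sup>2 * K)"
      by (simp add: norm_divide)
  qed
  also have "\<dots> = 4 * real m / (\<beta>\<^sup>2 * K)" by simp
  also have "\<dots> \<le> 1" using K \<beta>(1) by (simp add: divide_le_eq)
  finally have R: "block_radius m n K ?\<Psi> (m + i) \<le> 1 + 2 * Q" by simp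
  have ReT: "\<bar>Re T\<bar> \<le> real m / \<beta>\<^sup>2" "\<bar>Re Z\<bar> \<le> real m / \<beta>\<^sup>2"
    using bT bZ abs_Re_le_cmod order_trans by blast+
  have "(x i)\<^sup>2 \<ge> 0" by simp
  with t R \<Psi> TZ ReT eq \<open>Q \<ge> 0\<close> large show ?thesis by argo
qed

section \<open>Estimates at the exceptional zeros\<close>

lemma exceptional_gersgorin_bound:
  fixes \<rho> t R N :: real
  assumes "\<bar>t\<^sup>2 - \<rho>\<^sup>2\<bar> \<le> R * (\<bar>t\<bar> + 2 * \<rho>)" "\<bar>\<rho> - 4 * N\<bar> \<le> N / 4" "R \<le> N / 4" "N > 0"
  shows "N \<le> \<bar>t\<bar> \<and> \<bar>t\<bar> \<le> 10 * N"
proof -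
  define s where "s = \<bar>t\<bar>"
  have s: "s \<ge> 0" "s\<^sup>2 = t\<^sup>2" by (auto simp: s_def)
  have \<rho>: "15 / 4 * N \<le> \<rho>" "\<rho> \<le> 17 / 4 * N" using assms(2) by linarith+
  have "R * (s + 2 * \<rho>) \<le> N / 4 * (s + 17 / 2 * N)"
    using assms s \<rho> by (intro mult_mono) auto
  then have B: "\<bar>s\<^sup>2 - \<rho>\<^sup>2\<bar> \<le> N * s / 4 + 17 / 8 * N\<^sup>2"
    using assms(1) by (simp add: s(2) flip: s_def) (simp add: algebra_simps power2_eq_square)
  \<comment> \<open>The squares of 15/4 and 17/4 are 225/16, above 14, and 289/16, below 19.\<close>
  have \<rho>2: "14 * N\<^sup>2 \<le> \<rho>\<^sup>2" "\<rho>\<^sup>2 \<le> 19 * N\<^sup>2"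
    using power_mono[OF \<rho>(1), of 2] power_mono[OF \<rho>(2), of 2] assms(4) \<rho>
    by (auto simp: power_mult_distrib power2_eq_square)
  have "N \<le> s"
  proof (rule ccontr)
    assume "\<not> N \<le> s"
    then have "s\<^sup>2 \<le> N\<^sup>2" "N * s \<le> N\<^sup>2"
      using s(1) assms(4) power_mono[of s N 2] mult_left_mono[of s N N] by (auto simp: power2_eq_square)
    with B \<rho>2 have "N\<^sup>2 \<le> 0" by linarith
    with assms(4) show False by simp
  qed
  moreover have "s \<le> 10 * N"
  proof (rule ccontr)
    assume "\<not> s \<le> 10 * N"
    then have "s > 10 * N" by simp
    then have "10 * N * s \<le> s * s" "10 * N * N \<le> N * s"
      using s assms(4) by (auto intro: mult_right_mono mult_left_mono)
    with B \<rho>2 have "N * N \<le> 0" by (simp add: abs_le_iff power2_eq_square)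
    with assms(4) show False by (simp add: mult_le_0_iff)
  qed
  ultimately show ?thesis by (simp add: s_def)
qed

text \<open>If \<open>E * (1 + s)\<close> exceeded \<open>N / 4\<close>, then \<open>2 * N\<close>
  could be absorbed into it, giving \<open>s^2 < 9 * E * (1 + s)\<close> and hence
  \<open>s \<le> 1 + 18 * E\<close>. Then \<open>E * (1 + s)\<close> is bounded independently of
  \<open>N\<close>, against the size of \<open>N\<close>.\<close>

lemma quadratic_growth_bound:
  fixes s E N :: real
  assumes "s\<^sup>2 \<le> 2 * N + E * (1 + s)" "s \<ge> 0" "E \<ge> 0" "N \<ge> 4 * E * (2 + 18 * E)"
  shows "E * (1 + s) \<le> N / 4"
proof (rule ccontr)
  assume "\<not> ?thesis"
  then have N: "N / 4 < E * (1 + s)" by simp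
  then have "s\<^sup>2 < 9 * (E * (1 + s))" using assms(1) by linarith
  have "s \<le> 1 + 18 * E"
  proof (rule ccontr)
    assume s: "\<not> s \<le> 1 + 18 * E"
    then have "18 * E * s \<le> s * s" using assms by (intro mult_right_mono) auto
    moreover have "E * 1 \<le> E * s" using assms s by (intro mult_left_mono) auto
    moreover note s
    moreover have "E * (1 + s) = E * 1 + E * s" by (rule distrib_left)
    ultimately show False using \<open>s\<^sup>2 < 9 * (E * (1 + s))\<close> by (simp add: power2_eq_square)
  qed
  then have "E * (1 + s) \<le> E * (2 + 18 * E)" using assms(3) by (intro mult_left_mono) auto
  with N assms(4) show False by simp
qed

text \<open>Errors are kept linear in \<open>s\<close>, since \<open>s\<close> itself grows with
  \<open>n\<close>; \<open>quadratic_growth_bound\<close> later makes them at most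
  \<open>n / 4\<close>. The constant \<open>C\<close> collects all terms that stay bounded along the
  labelling, and \<open>E\<close> depends on \<open>C\<close>, \<open>\<beta>\<close> and
  \<open>K\<close> but not on \<open>n\<close>.\<close>

lemma exceptional_estimates:
  fixes lam :: "nat list" and m n k :: nat and C \<beta> K :: real
  assumes ev: "even (length lam)" and m: "m = sum_list lam"
    and conf: "zero_config lam n w z x" and k: "k < m"
    and \<beta>: "\<beta> > 0" "\<beta> \<le> \<bar>Im (z k)\<bar>" and K: "K > 0"
    and C: "cmod (z k) + (\<Sum>l\<in>{..<m} - {k}. cmod (1 / (z k - w l)) + cmod (1 / (z k - w l)\<^sup>2)
        + cmod (1 / (z k - z l)) + cmod (1 / (z k - z l)\<^sup>2)) \<le> C"
  defines "s \<equiv> cmod (1 / (z k - w k))"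
  defines "D \<equiv> 3 * C / \<beta> + 3 / \<beta> + 4 * C + 2 + C\<^sup>2"
  defines "E \<equiv> 2 * (1 + D + 2 * C + C / \<beta> + 1 / \<beta>) + 4 * C + 2 * K * (C / \<beta> + 1 / \<beta>)"
  defines "\<Psi> \<equiv> hess_symbol (gen_hermite lam) m n (all_zeros m z x)"
  shows "s\<^sup>2 \<le> 2 * real n + E * (1 + s)"
    and "cmod (\<Psi> k k + 4 * of_nat n) \<le> E * (1 + s)"
    and "block_radius m n K \<Psi> k \<le> E * (1 + s)"
    and "E \<ge> 0"
proof -
  let ?u = "all_zeros m z x" and ?L = "{..<m} - {k}"
  let ?v = "z k"
  have a: "k < m + n" using k by simp
  have ua: "?u k = ?v" using k by (simp add: all_zeros_def)
  define g1 where "g1 = (\<Sum>l\<in>?L. 1 / (?v - w l))"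
  define g2 where "g2 = (\<Sum>l\<in>?L. 1 / (?v - w l)\<^sup>2)"
  define s1 where "s1 = (\<Sum>l\<in>?L. 1 / (?v - z l))"
  define s2 where "s2 = (\<Sum>l\<in>?L. 1 / (?v - z l)\<^sup>2)"
  define n2 where "n2 = (\<Sum>l\<in>?L. cmod (1 / (?v - z l)\<^sup>2))"
  define X1 where "X1 = (\<Sum>i<n. 1 / (?v - complex_of_real (x i)))"
  define X2 where "X2 = (\<Sum>i<n. 1 / (?v - complex_of_real (x i))\<^sup>2)"
  \<comment> \<open>\<open>B\<close> bounds the modulus of \<open>X2\<close>, and
    \<open>2 * K * B\<close> is the contribution of the regular zeros to the radius, so one estimate
    of \<open>B\<close> serves both.\<close>
  define B where "B = (\<Sum>i<n. cmod (1 / (?v - complex_of_real (x i))\<^sup>2))"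
  \<comment> \<open>The one term of the weight sums not covered by \<open>C\<close>.\<close>
  define \<delta> where "\<delta> = 1 / (?v - w k)"
  have split: "(\<Sum>b\<in>{..<m + n} - {k}. f (?u b)) = (\<Sum>l\<in>?L. f (z l)) + (\<Sum>i<n. f (complex_of_real (x i)))"
    for f :: "complex \<Rightarrow> complex"
    unfolding sum_remove_low[OF k] by (intro arg_cong2[of _ _ _ _ "(+)"] sum.cong) (auto simp: all_zeros_def)
  have splitw: "(\<Sum>l<m. f (w l)) = f (w k) + (\<Sum>l\<in>?L. f (w l))" for f :: "complex \<Rightarrow> complex"
    using k by (intro sum.remove) auto
  have d2: "1 / (?v - w k)\<^sup>2 = \<delta>\<^sup>2" by (simp add: \<delta>_def power_divide)
  have rel1: "s1 + X1 = ?v + (\<delta> + g1)"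
    using zero_config_relations(3)[OF ev m conf a, unfolded ua]
      split[of "\<lambda>y. 1 / (?v - y)"] splitw[of "\<lambda>y. 1 / (?v - y)"]
    by (simp only: s1_def X1_def g1_def \<delta>_def)
  have rel2: "3 * (s2 + X2) = 2 * of_nat n - 2 + (\<delta>\<^sup>2 + g2) - ?v\<^sup>2"
    using zero_config_relations(4)[OF ev m conf a, unfolded ua]
      split[of "\<lambda>y. 1 / (?v - y)\<^sup>2"] splitw[of "\<lambda>y. 1 / (?v - y)\<^sup>2"]
    by (simp only: s2_def X2_def g2_def d2)
  have rel3: "\<Psi> k k = - 2 + 2 * (\<delta>\<^sup>2 + g2) - 2 * (s2 + X2)"
    using zero_config_relations(5)[OF ev m conf a, unfolded ua]
      split[of "\<lambda>y. 1 / (?v - y)\<^sup>2"] splitw[of "\<lambda>y. 1 / (?v - y)\<^sup>2"]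
    by (simp only: \<Psi>_def s2_def X2_def g2_def d2)
  have C': "cmod ?v + ((\<Sum>l\<in>?L. cmod (1 / (?v - w l))) + (\<Sum>l\<in>?L. cmod (1 / (?v - w l)\<^sup>2))
      + (\<Sum>l\<in>?L. cmod (1 / (?v - z l))) + n2) \<le> C"
    using C by (simp only: sum.distrib n2_def)
  have nn: "n2 \<ge> 0" "B \<ge> 0" "s \<ge> 0" "cmod ?v \<ge> 0"
    by (auto simp: n2_def B_def s_def intro: sum_nonneg)
  have ng: "cmod g1 \<le> (\<Sum>l\<in>?L. cmod (1 / (?v - w l)))" "cmod g2 \<le> (\<Sum>l\<in>?L. cmod (1 / (?v - w l)\<^sup>2))"
    "cmod s1 \<le> (\<Sum>l\<in>?L. cmod (1 / (?v - z l)))" "cmod s2 \<le> n2"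
    by (auto simp only: g1_def g2_def s1_def s2_def n2_def intro: norm_sum)
  have bounds: "cmod ?v + cmod g1 + cmod s1 \<le> C" "cmod g2 \<le> C" "n2 \<le> C" "cmod s2 \<le> C" "cmod ?v \<le> C" "0 \<le> C"
    using C' ng nn norm_ge_zero[of g1] norm_ge_zero[of g2] norm_ge_zero[of s1] norm_ge_zero[of s2] by linarith+
  have "\<bar>Im ?v\<bar> * B = \<bar>Im X1\<bar>"
  proof -
    have "Im (1 / (?v - complex_of_real t)) = - Im ?v * cmod (1 / (?v - complex_of_real t)\<^sup>2)" for t
      by (simp add: Im_divide cmod_power2 norm_divide norm_power)
    then have "Im X1 = - Im ?v * B"
      by (simp only: X1_def B_def Im_sum sum_distrib_left)
    then show ?thesis using nn(2) by (simp add: abs_mult)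
  qed
  moreover have "\<beta> * B \<le> \<bar>Im ?v\<bar> * B" using \<beta>(2) nn(2) by (rule mult_right_mono)
  moreover have "\<bar>Im X1\<bar> \<le> cmod X1" by (rule abs_Im_le_cmod)
  moreover have "cmod X1 \<le> C + s"
  proof -
    have "X1 = ?v + \<delta> + g1 - s1" using rel1 by (simp add: algebra_simps)
    then have "cmod X1 \<le> cmod ?v + cmod \<delta> + cmod g1 + cmod s1"
      using norm_triangle_ineq4[of "?v + \<delta> + g1" s1] norm_triangle_ineq[of "?v + \<delta>" g1] norm_triangle_ineq[of ?v \<delta>]
      by simp
    then show ?thesis using bounds(1) by (simp add: s_def \<delta>_def)
  qed
  ultimately have "\<beta> * B \<le> C + s" by linarith
  then have B: "B \<le> C / \<beta> + s / \<beta>"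
    using \<beta>(1) by (simp add: add_divide_distrib[symmetric] le_divide_eq mult.commute)
  have X2: "cmod X2 \<le> B" unfolding X2_def B_def by (rule norm_sum)
  then have S2: "cmod (s2 + X2) \<le> C + C / \<beta> + s / \<beta>"
    using norm_triangle_ineq[of s2 X2] bounds(4) B by linarith
  have v2: "cmod (?v\<^sup>2) \<le> C\<^sup>2" using bounds(5) by (simp add: norm_power power_mono)
  have D0: "D \<ge> 0" "C / \<beta> \<ge> 0" "1 / \<beta> \<ge> 0" using bounds(6) \<beta>(1) by (auto simp: D_def)
  have "\<delta>\<^sup>2 + 2 * of_nat n = 3 * (s2 + X2) + 2 - g2 + ?v\<^sup>2" using rel2 by (simp add: algebra_simps)
  then have "cmod (\<delta>\<^sup>2 + 2 * of_nat n) = cmod (3 * (s2 + X2) + 2 - g2 + ?v\<^sup>2)" by (simp only:)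
  moreover have "cmod (3 * (s2 + X2)) = 3 * cmod (s2 + X2)" "cmod (2 :: complex) = 2"
    by (simp_all only: norm_mult norm_numeral)
  ultimately have "cmod (\<delta>\<^sup>2 + 2 * of_nat n) \<le> 3 * cmod (s2 + X2) + 2 + cmod g2 + cmod (?v\<^sup>2)"
    using norm_triangle_ineq[of "3 * (s2 + X2) + 2 - g2" "?v\<^sup>2"] norm_triangle_ineq4[of "3 * (s2 + X2) + 2" g2]
      norm_triangle_ineq[of "3 * (s2 + X2)" 2] by linarith
  also have "\<dots> \<le> 3 * (C + C / \<beta> + s / \<beta>) + 2 + C + C\<^sup>2"
    by (intro add_mono mult_left_mono S2 bounds(2) v2) auto
  also have "\<dots> = 4 * C + 2 + C\<^sup>2 + 3 * C / \<beta> + 3 / \<beta> * s"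
    by (simp add: algebra_simps)
  also have "\<dots> \<le> D + D * s"
  proof (intro add_mono mult_right_mono)
    show "4 * C + 2 + C\<^sup>2 + 3 * C / \<beta> \<le> D" using D0 by (simp add: D_def)
    show "3 / \<beta> \<le> D" using D0 bounds(6) by (simp add: D_def)
  qed (rule nn)
  finally have T: "cmod (\<delta>\<^sup>2 + 2 * of_nat n) \<le> D * (1 + s)" by (simp add: algebra_simps)
  define E1 where "E1 = 2 * (1 + D + 2 * C + C / \<beta> + 1 / \<beta>)"
  define E2 where "E2 = 4 * C + 2 * K * (C / \<beta> + 1 / \<beta>)"
  have E: "E = E1 + E2" by (simp add: E_def E1_def E2_def)
  have E12: "E1 \<ge> 0" "E2 \<ge> 0" "D \<le> E1" using D0 bounds(6) K by (auto simp: E1_def E2_def)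
  then show "E \<ge> 0" by (simp add: E)
  have mono: "F * (1 + s) \<le> E * (1 + s)" if "F \<le> E" for F
    using that nn(3) by (intro mult_right_mono) auto
  have "s\<^sup>2 = cmod (\<delta>\<^sup>2)" by (simp add: s_def \<delta>_def norm_power)
  also have "\<dots> \<le> cmod (\<delta>\<^sup>2 + 2 * of_nat n) + cmod (2 * of_nat n)"
    using norm_triangle_ineq4[of "\<delta>\<^sup>2 + 2 * of_nat n" "2 * of_nat n"] by simp
  also have "cmod (2 * of_nat n :: complex) = 2 * real n" by (simp add: norm_mult)
  finally show "s\<^sup>2 \<le> 2 * real n + E * (1 + s)"
    using T mono[of D] E E12 by simp
  have "\<Psi> k k + 4 * of_nat n = - 2 + 2 * (\<delta>\<^sup>2 + 2 * of_nat n) + 2 * g2 - 2 * (s2 + X2)"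
    unfolding rel3 by (simp add: algebra_simps)
  then have "cmod (\<Psi> k k + 4 * of_nat n) \<le> 2 + 2 * cmod (\<delta>\<^sup>2 + 2 * of_nat n) + 2 * cmod g2 + 2 * cmod (s2 + X2)"
    using norm_triangle_ineq4[of "- 2 + 2 * (\<delta>\<^sup>2 + 2 * of_nat n) + 2 * g2" "2 * (s2 + X2)"]
      norm_triangle_ineq[of "- 2 + 2 * (\<delta>\<^sup>2 + 2 * of_nat n)" "2 * g2"]
      norm_triangle_ineq[of "- 2" "2 * (\<delta>\<^sup>2 + 2 * of_nat n)"] by (simp only: norm_mult norm_minus_cancel norm_numeral)
  also have "\<dots> \<le> 2 + 2 * (D * (1 + s)) + 2 * C + 2 * (C + C / \<beta> + s / \<beta>)"
    by (intro add_mono mult_left_mono T S2 bounds(2)) auto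
  also have "\<dots> = (2 + 2 * D + 4 * C + 2 * (C / \<beta>)) + (2 * D + 2 * (1 / \<beta>)) * s"
    by (simp add: algebra_simps)
  also have "\<dots> \<le> E1 + E1 * s"
    using D0 bounds(6) by (intro add_mono mult_right_mono nn(3)) (auto simp: E1_def)
  also have "\<dots> \<le> E * (1 + s)" using mono[of E1] E E12 by (simp add: algebra_simps)
  finally show "cmod (\<Psi> k k + 4 * of_nat n) \<le> E * (1 + s)" .
  have "block_radius m n K \<Psi> k = (\<Sum>l\<in>?L. 4 * cmod (1 / (?v - z l)\<^sup>2))
      + (\<Sum>i<n. 2 * K * cmod (1 / (?v - complex_of_real (x i))\<^sup>2))"
    unfolding block_radius_def sum_remove_low[OF k] using k
    by (intro arg_cong2[of _ _ _ _ "(+)"] sum.cong)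
      (auto simp: block_size_def scale_factor_def \<Psi>_def hess_symbol_def all_zeros_def norm_divide)
  also have "\<dots> = 4 * n2 + 2 * K * B"
    by (simp only: n2_def B_def sum_distrib_left)
  also have "\<dots> \<le> 4 * C + 2 * K * (C / \<beta> + s / \<beta>)"
    using bounds(3) B K by (intro add_mono mult_left_mono) auto
  also have "\<dots> = (4 * C + 2 * K * (C / \<beta>)) + 2 * K * (1 / \<beta>) * s"
    by (simp add: algebra_simps)
  also have "\<dots> \<le> E2 + E2 * s"
    using D0 bounds(6) K by (intro add_mono mult_right_mono nn(3)) (auto simp: E2_def distrib_left)
  also have "\<dots> \<le> E * (1 + s)" using mono[of E2] E E12 by (simp add: algebra_simps)
  finally show "block_radius m n K \<Psi> k \<le> E * (1 + s)" .
qed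

section \<open>Passage to large degree\<close>

lemma zero_labelling_eventually_config:
  assumes "zero_labelling lam w z x"
  shows "\<forall>\<^sub>F n in sequentially. zero_config lam n w (z n) (x n)"
  using assms by (auto simp: zero_labelling_def zero_config_def elim: eventually_mono)

text \<open>The conjugate of a non-real zero is another non-real zero; if they had the same limit the
  labelling would not be injective.\<close>

lemma zero_labelling_nonreal:
  assumes lab: "zero_labelling lam w z x" and k: "k < sum_list lam"
  shows "Im (w k) \<noteq> 0"
proof
  assume "Im (w k) = 0"
  then have wk: "cnj (w k) = w k" by (simp add: complex_eq_iff)
  have lim: "(\<lambda>n. z n l) \<longlonglongrightarrow> w l" if "l < sum_list lam" for l
    using lab that by (simp add: zero_labelling_def)
  have "\<forall>\<^sub>F n in sequentially. \<forall>l\<in>{..<sum_list lam} - {k}. z n l - cnj (z n k) \<noteq> 0"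
  proof (intro eventually_ball_finite ballI)
    fix l assume l: "l \<in> {..<sum_list lam} - {k}"
    have "(\<lambda>n. z n l - cnj (z n k)) \<longlonglongrightarrow> w l - cnj (w k)"
      using l k by (intro tendsto_diff tendsto_cnj lim) auto
    moreover have "w l - cnj (w k) \<noteq> 0"
      using lab l k unfolding wk by (auto simp: zero_labelling_def bij_betw_def dest: inj_onD)
    ultimately show "\<forall>\<^sub>F n in sequentially. z n l - cnj (z n k) \<noteq> 0"
      by (rule tendsto_imp_eventually_ne)
  qed simp
  with zero_labelling_eventually_config[OF lab] have "\<forall>\<^sub>F n in sequentially. False"
  proof eventually_elim
    case (elim n)
    then have root: "z n k \<in> {u. poly (exc_hermite lam n) u = 0 \<and> Im u \<noteq> 0}"
      using k by (auto simp: zero_config_def bij_betw_def)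
    have "cnj (poly (exc_hermite lam n) (z n k)) = poly (exc_hermite lam n) (cnj (z n k))"
      using real_coeffs_exc_hermite by (intro poly_cnj_real) (simp add: real_coeffs_def)
    then have "cnj (z n k) \<in> {u. poly (exc_hermite lam n) u = 0 \<and> Im u \<noteq> 0}"
      using root by simp
    also have "\<dots> = z n ` {..<sum_list lam}"
      using elim by (auto simp: zero_config_def bij_betw_def)
    finally obtain l where l: "l < sum_list lam" "cnj (z n k) = z n l" by auto
    then have "l = k" using elim(2) by (metis Diff_iff cancel_comm_monoid_add_class.diff_cancel empty_iff insert_iff lessThan_iff)
    then have "Im (z n k) = 0" using l(2) by (simp add: complex_eq_iff)
    then show False using root by simp
  qed
  then show False by simp
qed

text \<open>All terms converge because the limits \<open>w l\<close> are distinct and the index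
  \<open>k\<close> is left out. The bound may depend on the labelling, as it only affects how large
  \<open>n\<close> must be.\<close>

lemma labelled_zero_bounds:
  assumes lab: "zero_labelling lam w z x" and m: "m = sum_list lam" and k: "k < m"
  shows "\<exists>C. \<forall>\<^sub>F n in sequentially. cmod (z n k) + (\<Sum>l\<in>{..<m} - {k}. cmod (1 / (z n k - w l))
    + cmod (1 / (z n k - w l)\<^sup>2) + cmod (1 / (z n k - z n l)) + cmod (1 / (z n k - z n l)\<^sup>2)) \<le> C"
proof -
  have lim: "(\<lambda>n. z n l) \<longlonglongrightarrow> w l" if "l < m" for l
    using lab that m by (simp add: zero_labelling_def)
  have ne: "w k - w l \<noteq> 0" if "l \<in> {..<m} - {k}" for l
    using lab that m k by (auto simp: zero_labelling_def bij_betw_def dest: inj_onD)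
  let ?f = "\<lambda>n. cmod (z n k) + (\<Sum>l\<in>{..<m} - {k}. cmod (1 / (z n k - w l))
    + cmod (1 / (z n k - w l)\<^sup>2) + cmod (1 / (z n k - z n l)) + cmod (1 / (z n k - z n l)\<^sup>2))"
  let ?g = "cmod (w k) + (\<Sum>l\<in>{..<m} - {k}. cmod (1 / (w k - w l))
    + cmod (1 / (w k - w l)\<^sup>2) + cmod (1 / (w k - w l)) + cmod (1 / (w k - w l)\<^sup>2))"
  have "?f \<longlonglongrightarrow> ?g"
    by (intro tendsto_intros lim k) (use ne in auto)
  then have "\<forall>\<^sub>F n in sequentially. ?f n < ?g + 1"
    by (rule order_tendstoD) simp
  then show ?thesis by (intro exI[of _ "?g + 1"]) (auto elim: eventually_mono)
qed

lemma eventually_regular_bound: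
  fixes lam :: "nat list" and m :: nat
  assumes ev: "even (length lam)" and m: "m = sum_list lam"
    and lab: "zero_labelling lam w z x"
    and \<beta>: "\<beta> > 0" "\<And>k. k < m \<Longrightarrow> \<beta> < \<bar>Im (w k)\<bar>"
    and K: "K > 0" "4 * real m \<le> \<beta>\<^sup>2 * K"
  shows "\<forall>\<^sub>F n in sequentially.
    \<forall>t\<in>G_reg m n (scaled_hessian lam n K (z n) (x n)). t < 0 \<and> \<bar>t\<bar> \<le> 4 * real n"
proof -
  have lim: "(\<lambda>n. z n l) \<longlonglongrightarrow> w l" if "l < m" for l
    using lab that m by (simp add: zero_labelling_def)
  have "\<forall>\<^sub>F n in sequentially. \<forall>k\<in>{..<m}. \<beta> < \<bar>Im (z n k)\<bar>"
  proof (intro eventually_ball_finite ballI)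
    fix k assume "k \<in> {..<m}"
    then show "\<forall>\<^sub>F n in sequentially. \<beta> < \<bar>Im (z n k)\<bar>"
      using order_tendstoD(1)[OF tendsto_rabs[OF tendsto_Im[OF lim]]] \<beta>(2) by simp
  qed simp
  moreover have "(\<lambda>n. \<Sum>k<m. cmod (z n k - w k)) \<longlonglongrightarrow> (\<Sum>k<m. cmod (w k - w k))"
    by (intro tendsto_intros lim) simp
  then have "\<forall>\<^sub>F n in sequentially. (\<Sum>k<m. cmod (z n k - w k)) < \<beta> ^ 3 / 16"
    using \<beta>(1) by (intro order_tendstoD(2)) auto
  moreover have "\<forall>\<^sub>F n in sequentially. 4 + 6 * real m / \<beta>\<^sup>2 \<le> real n"
    by (rule eventually_sequentiallyI[of "nat \<lceil>4 + 6 * real m / \<beta>\<^sup>2\<rceil>"]) linarith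
  moreover note zero_labelling_eventually_config[OF lab]
  ultimately show ?thesis
  proof eventually_elim
    case (elim n)
    let ?\<Psi> = "hess_symbol (gen_hermite lam) m n (all_zeros m (z n) (x n))"
    show ?case
    proof
      fix t assume "t \<in> G_reg m n (scaled_hessian lam n K (z n) (x n))"
      then obtain i where i: "i < n" "complex_of_real t \<in>
          gersgorin m n (map_mat complex_of_real (scaled_hessian lam n K (z n) (x n))) (m + i)"
        by (auto simp: G_reg_def)
      have "\<bar>t - Re (?\<Psi> (m + i) (m + i))\<bar> \<le> block_radius m n K ?\<Psi> (m + i)"
        using gersgorin_singleton[OF interaction_scaled_hessian[OF ev m elim(4) K(1)] _ _ K(1) i(2)] i(1)
        by simp
      then show "t < 0 \<and> \<bar>t\<bar> \<le> 4 * real n"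
        using elim \<beta> K i(1)
        by (intro regular_gersgorin_bound[OF ev m elim(4) i(1) \<beta>(1) _ _ _ K]) (auto intro: less_imp_le)
    qed
  qed
qed

lemma eventually_exceptional_bound:
  fixes lam :: "nat list" and m :: nat
  assumes ev: "even (length lam)" and m: "m = sum_list lam"
    and lab: "zero_labelling lam w z x" and K: "K > 0"
  shows "\<forall>\<^sub>F n in sequentially.
    \<forall>t\<in>G_exc m n (scaled_hessian lam n K (z n) (x n)). real n \<le> \<bar>t\<bar> \<and> \<bar>t\<bar> \<le> 10 * real n"
proof -
  let ?\<Psi> = "\<lambda>n. hess_symbol (gen_hermite lam) m n (all_zeros m (z n) (x n))"
  have "\<forall>\<^sub>F n in sequentially. \<forall>k\<in>{..<m}.
      cmod (?\<Psi> n k k + 4 * of_nat n) \<le> real n / 4 \<and> block_radius m n K (?\<Psi> n) k \<le> real n / 4"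
  proof (intro eventually_ball_finite ballI)
    fix k assume "k \<in> {..<m}"
    then have k: "k < m" by simp
    \<comment> \<open>Half the limiting distance to the real line, so that the bound is inherited by
      \<open>z n k\<close> for large \<open>n\<close>. It is chosen for each \<open>k\<close>
      separately.\<close>
    define \<beta> where "\<beta> = \<bar>Im (w k)\<bar> / 2"
    have \<beta>: "\<beta> > 0" "\<beta> < \<bar>Im (w k)\<bar>"
      using zero_labelling_nonreal[OF lab, of k] k m by (auto simp: \<beta>_def)
    have "(\<lambda>n. z n k) \<longlonglongrightarrow> w k"
      using lab k m by (simp add: zero_labelling_def)
    then have Im_z: "\<forall>\<^sub>F n in sequentially. \<beta> < \<bar>Im (z n k)\<bar>"
      using order_tendstoD(1)[OF tendsto_rabs[OF tendsto_Im]] \<beta>(2) by blast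
    from labelled_zero_bounds[OF lab m k] obtain C where C: "\<forall>\<^sub>F n in sequentially.
        cmod (z n k) + (\<Sum>l\<in>{..<m} - {k}. cmod (1 / (z n k - w l)) + cmod (1 / (z n k - w l)\<^sup>2)
          + cmod (1 / (z n k - z n l)) + cmod (1 / (z n k - z n l)\<^sup>2)) \<le> C" ..
    define D where "D = 3 * C / \<beta> + 3 / \<beta> + 4 * C + 2 + C\<^sup>2"
    define E where "E = 2 * (1 + D + 2 * C + C / \<beta> + 1 / \<beta>) + 4 * C + 2 * K * (C / \<beta> + 1 / \<beta>)"
    have "\<forall>\<^sub>F n in sequentially. 4 * E * (2 + 18 * E) \<le> real n"
      by (rule eventually_sequentiallyI[of "nat \<lceil>4 * E * (2 + 18 * E)\<rceil>"]) linarith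
    with zero_labelling_eventually_config[OF lab] Im_z C
    show "\<forall>\<^sub>F n in sequentially.
      cmod (?\<Psi> n k k + 4 * of_nat n) \<le> real n / 4 \<and> block_radius m n K (?\<Psi> n) k \<le> real n / 4"
    proof eventually_elim
      case (elim n)
      note est = exceptional_estimates[OF ev m elim(1) k \<beta>(1) less_imp_le[OF elim(2)] K elim(3),
        folded D_def, folded E_def]
      have "E * (1 + cmod (1 / (z n k - w k))) \<le> real n / 4"
        using est elim(4) by (intro quadratic_growth_bound) auto
      with est(2,3) show ?case by linarith
    qed
  qed simp
  with zero_labelling_eventually_config[OF lab] eventually_gt_at_top[of "0::nat"]
  show ?thesis
  proof eventually_elim
    case (elim n)
    show ?case
    proof
      fix t assume "t \<in> G_exc m n (scaled_hessian lam n K (z n) (x n))"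
      then obtain k where k: "k < m" "complex_of_real t \<in>
          gersgorin m n (map_mat complex_of_real (scaled_hessian lam n K (z n) (x n))) k"
        by (auto simp: G_exc_def)
      have g: "\<bar>t\<^sup>2 - (cmod (?\<Psi> n k k))\<^sup>2\<bar> \<le> block_radius m n K (?\<Psi> n) k * (\<bar>t\<bar> + 2 * cmod (?\<Psi> n k k))"
        by (rule gersgorin_pair[OF interaction_scaled_hessian[OF ev m elim(1) K] k(1) K k(2)])
      have "\<bar>cmod (?\<Psi> n k k) - 4 * real n\<bar> \<le> cmod (?\<Psi> n k k + 4 * of_nat n)"
        using norm_triangle_ineq3[of "?\<Psi> n k k" "- 4 * of_nat n"] by (simp add: norm_mult)
      then have \<rho>: "\<bar>cmod (?\<Psi> n k k) - 4 * real n\<bar> \<le> real n / 4"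
        using elim(3) k(1) by (meson lessThan_iff order_trans)
      show "real n \<le> \<bar>t\<bar> \<and> \<bar>t\<bar> \<le> 10 * real n"
        by (rule exceptional_gersgorin_bound[OF g \<rho>]) (use elim(2,3) k(1) in auto)
    qed
  qed
qed

theorem theorem2:
  fixes lam :: "nat list" and m :: nat
  assumes "even_partition lam"
    and "m = sum_list lam"
    and "\<forall>u. poly (gen_hermite lam) u = 0 \<longrightarrow> Polynomial.order u (gen_hermite lam) = 1"
  shows "\<exists>K>0. \<exists>c>0. \<exists>c1>0. \<exists>c2>0.
    \<forall>(w :: nat \<Rightarrow> complex) (z :: nat \<Rightarrow> nat \<Rightarrow> complex) (x :: nat \<Rightarrow> nat \<Rightarrow> real).
      zero_labelling lam w z x \<longrightarrow>
      (\<forall>\<^sub>F n in sequentially.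
        (\<forall>t\<in>G_reg m n (scaled_hessian lam n K (z n) (x n)). t < 0 \<and> \<bar>t\<bar> \<le> c * real n) \<and>
        (\<forall>t\<in>G_exc m n (scaled_hessian lam n K (z n) (x n)).
            c1 * real n \<le> \<bar>t\<bar> \<and> \<bar>t\<bar> \<le> c2 * real n))"
proof -
  define S where "S = {u. poly (gen_hermite lam) u = 0}"
  \<comment> \<open>\<open>K\<close> must be fixed before any labelling is given, so
    \<open>\<beta>\<close> is taken from the zero set of \<open>H\<close>. The inserted 1 keeps the
    minimum meaningful when there are no zeros, and the half gives the strict inequality needed for
    passing to nearby zeros.\<close>
  define \<beta> where "\<beta> = Min (insert 1 ((\<lambda>u. \<bar>Im u\<bar>) ` S)) / 2"
  define K where "K = 4 * real m / \<beta>\<^sup>2 + 1"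
  have ev: "even (length lam)" using assms(1) by (simp add: even_partition_def)
  \<comment> \<open>Valid for every value of \<open>\<beta>\<close>, even 0 under division by zero;
    \<open>\<beta> > 0\<close> is shown in \<open>main\<close>, where a labelling makes the zeros of
    \<open>H\<close> non-real.\<close>
  have "K > 0" by (simp add: K_def add_nonneg_pos)
  have main: "\<forall>\<^sub>F n in sequentially.
      (\<forall>t\<in>G_reg m n (scaled_hessian lam n K (z n) (x n)). t < 0 \<and> \<bar>t\<bar> \<le> 4 * real n) \<and>
      (\<forall>t\<in>G_exc m n (scaled_hessian lam n K (z n) (x n)). 1 * real n \<le> \<bar>t\<bar> \<and> \<bar>t\<bar> \<le> 10 * real n)"
    if lab: "zero_labelling lam w z x" for w z x
  proof -
    have S: "S = w ` {..<m}"
      using lab assms(2) by (auto simp: S_def zero_labelling_def bij_betw_def)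
    then have fin: "finite (insert 1 ((\<lambda>u. \<bar>Im u\<bar>) ` S))" by simp
    have "y > 0" if "y \<in> insert 1 ((\<lambda>u. \<bar>Im u\<bar>) ` S)" for y
      using that zero_labelling_nonreal[OF lab] assms(2) by (auto simp: S)
    then have \<beta>: "\<beta> > 0"
      using Min_in[OF fin] by (simp add: \<beta>_def)
    have "2 * \<beta> \<le> \<bar>Im (w k)\<bar>" if "k < m" for k
      using Min_le[OF fin, of "\<bar>Im (w k)\<bar>"] that by (simp add: \<beta>_def S)
    then have "\<beta> < \<bar>Im (w k)\<bar>" if "k < m" for k
      using \<beta> that by fastforce
    moreover have "4 * real m \<le> \<beta>\<^sup>2 * K"
      using \<beta> by (simp add: K_def distrib_left)
    ultimately show ?thesis
      using eventually_conj[OF eventually_regular_bound[OF ev assms(2) lab \<beta> _ \<open>K > 0\<close>]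
          eventually_exceptional_bound[OF ev assms(2) lab \<open>K > 0\<close>]]
      by simp
  qed
  show ?thesis
    by (rule exI[of _ K], rule conjI[OF \<open>K > 0\<close>], rule exI[of _ 4], rule conjI, simp,
        rule exI[of _ 1], rule conjI, simp, rule exI[of _ 10], rule conjI, simp)
      (use main in blast)
qed

end
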